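(* There exists a constant $\tilde{\mathcal{C}}>0$ such that the following holds. Let $u_0\in A^0(\mathbb{S}^1)$ with $u_0>0$ on $\mathbb{S}^1$, denote $$\langle u_0\rangle=\frac{1}{2\pi}\int_{\mathbb{S}^1}u_0(x)\,dx,$$ and suppose that $$\frac{\|u_0-\langle u_0\rangle\|_{A^0}}{\langle u_0\rangle}\le\tilde{\mathcal{C}}.$$ Then there exists at least one global weak solution $u$ of $$\partial_t u+\partial_x\arctan\left(\frac{Hu}{u}\right)=0,\qquad u(x,0)=u_0(x),\qquad x\in\mathbb{S}^1,$$ with $$u\in L^\infty([0,T]\times\mathbb{S}^1)\cap L^2(0,T;H^{0.5}(\mathbb{S}^1))\qquad\text{for all } 0<T<\infty,$$ and this solution satisfies $$\|u(t)-\langle u_0\rangle\|_{L^\infty}\le\|u_0-\langle u_0\rangle\|_{A^0}\,e^{-\delta t}$$ for almost every $t\ge0$, for a certain small enough $\delta=\delta(\langle u_0\rangle)>0$.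
   Context: $\mathbb{S}^1$ is the circle $\mathbb{R}/2\pi\mathbb{Z}$, and functions on it are real-valued and $2\pi$-periodic. $H$ is the periodic Hilbert transform in the space variable, $$Hu(x)=\frac{1}{2\pi}\,\mathrm{p.v.}\!\int_{\mathbb{S}^1}\frac{u(y)}{\tan\left(\frac{x-y}{2}\right)}\,dy,$$ where p.v. denotes principal value. Write $u(x)=\sum_{n\in\mathbb{Z}}\hat u(n)e^{inx}$ and let $\Lambda=H\partial_x$, i.e. the Fourier multiplier with symbol $|n|$. The space $H^s(\mathbb{S}^1)$ consists of the functions $u$ with $\sum_{n}|n|^{2s}|\hat u(n)|^2<\infty$, and $\|u\|_{H^s}=\|\Lambda^s u\|_{L^2}$. The Wiener space $A^s(\mathbb{S}^1)$ consists of the functions $u$ with $\sum_{n}|n|^{s}|\hat u(n)|<\infty$, and $\|u\|_{A^s}=\sum_{n}|n|^s|\hat u(n)|$, with the convention $|0|^0=1$, so that $\|u\|_{A^0}=\sum_n|\hat u(n)|$. A function $u$ is a global weak solution with initial data $u_0$ if for every $0<T<\infty$ $$-\int_0^T\int_{\mathbb{S}^1}\left[u(x,s)\,\partial_t\phi(x,s)+\arctan\left(\frac{Hu(x,s)}{u(x,s)}\right)\partial_x\phi(x,s)\right]dx\,ds=\int_{\mathbb{S}^1}u_0(x)\,\phi(x,0)\,dx$$ for all test functions $\phi\in C_c^\infty(\mathbb{S}^1\times[0,T))$ (smooth, vanishing for $t$ near $T$, not necessarily vanishing at $t=0$). *)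

theory Defs
  imports "HOL-Probability.Probability"
begin

text \<open>Functions on the circle are functions on the real line with period \<open>2 * pi\<close>; integrals over
  the circle are taken over \<open>{0..2*pi}\<close>. Space-time functions are written \<open>u t x\<close>, with time
  first, so that \<open>u t\<close> is the spatial slice.\<close>

definition periodic :: "(real \<Rightarrow> real) \<Rightarrow> bool" where
  "periodic f \<longleftrightarrow> (\<forall>x. f (x + 2 * pi) = f x)"

definition circle_mean :: "(real \<Rightarrow> real) \<Rightarrow> real" where
  "circle_mean f = 1 / (2 * pi) * (LINT x:{0..2*pi}|lebesgue. f x)"

definition fourier_coeff :: "(real \<Rightarrow> real) \<Rightarrow> int \<Rightarrow> complex" where
  "fourier_coeff f n =
     complex_of_real (1 / (2 * pi)) *
       (LINT x:{0..2*pi}|lebesgue. complex_of_real (f x) * cis (- (of_int n * x)))"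

text \<open>The weight \<open>|n|^s\<close> with \<open>|0|^0 = 1\<close>; the case distinction is needed
  because \<open>0 powr 0 = 0\<close>.\<close>

definition freq_weight :: "real \<Rightarrow> int \<Rightarrow> real" where
  "freq_weight s n = (if s = 0 then 1 else \<bar>real_of_int n\<bar> powr s)"

text \<open>Elements of the function spaces are integrable functions, not equivalence classes: membership
  and norm depend only on the class modulo null sets.\<close>

definition wiener_space :: "real \<Rightarrow> (real \<Rightarrow> real) set" where
  "wiener_space s = {f. periodic f \<and> f absolutely_integrable_on {0..2*pi} \<and>
     (\<lambda>n. freq_weight s n * cmod (fourier_coeff f n)) summable_on UNIV}"

definition wiener_norm :: "real \<Rightarrow> (real \<Rightarrow> real) \<Rightarrow> real" where
  "wiener_norm s f = (\<Sum>\<^sub>\<infinity>n. freq_weight s n * cmod (fourier_coeff f n))"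

definition sobolev_space :: "real \<Rightarrow> (real \<Rightarrow> real) set" where
  "sobolev_space s = {f. periodic f \<and> f absolutely_integrable_on {0..2*pi} \<and>
     (\<lambda>n. freq_weight (2 * s) n * (cmod (fourier_coeff f n))\<^sup>2) summable_on UNIV}"

text \<open>The \<open>L\<^sup>2\<close> norm of the function with Fourier coefficients \<open>|n|^s * fourier_coeff f n\<close>;
  the factor \<open>2 * pi\<close> is the one in Parseval's identity for the unnormalised measure on the
  circle.\<close>

definition sobolev_norm :: "real \<Rightarrow> (real \<Rightarrow> real) \<Rightarrow> real" where
  "sobolev_norm s f =
     sqrt (2 * pi * (\<Sum>\<^sub>\<infinity>n. freq_weight (2 * s) n * (cmod (fourier_coeff f n))\<^sup>2))"

text \<open>The principal value is taken over the period \<open>{x - pi..x + pi}\<close> centred at \<open>x\<close>, in which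
  \<open>y = x\<close> is the only singularity of the kernel. (\<open>tan (pi / 2) = 0\<close> in the library, so
  the quotient takes the correct value \<open>0\<close> at the endpoints.) \<open>Lim\<close> is unspecified if there is
  no limit, hence the separate predicate for the existence of the principal value.\<close>

definition hilbert_truncated :: "(real \<Rightarrow> real) \<Rightarrow> real \<Rightarrow> real \<Rightarrow> real" where
  "hilbert_truncated f x \<epsilon> =
     1 / (2 * pi) * (LINT y:{y. \<epsilon> \<le> \<bar>x - y\<bar> \<and> \<bar>x - y\<bar> \<le> pi}|lebesgue. f y / tan ((x - y) / 2))"

definition hilbert_exists :: "(real \<Rightarrow> real) \<Rightarrow> real \<Rightarrow> bool" where
  "hilbert_exists f x \<longleftrightarrow> (\<exists>l. (hilbert_truncated f x \<longlongrightarrow> l) (at_right 0))"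

definition hilbert :: "(real \<Rightarrow> real) \<Rightarrow> real \<Rightarrow> real" where
  "hilbert f x = Lim (at_right 0) (hilbert_truncated f x)"

definition flux :: "(real \<Rightarrow> real \<Rightarrow> real) \<Rightarrow> real \<Rightarrow> real \<Rightarrow> real" where
  "flux u t x = arctan (hilbert (u t) x / u t x)"

text \<open>On \<open>{0..<T} \<times> UNIV\<close> derivatives within the set are unique, and those in time are one-sided
  at time \<open>0\<close>.\<close>

primrec cont_diff_on :: "nat \<Rightarrow> (real \<times> real \<Rightarrow> real) \<Rightarrow> (real \<times> real) set \<Rightarrow> bool" where
  "cont_diff_on 0 f S \<longleftrightarrow> continuous_on S f"
| "cont_diff_on (Suc k) f S \<longleftrightarrow>
     (\<exists>f1 f2. (\<forall>p\<in>S. (f has_derivative (\<lambda>h. f1 p * fst h + f2 p * snd h)) (at p within S)) \<and>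
        cont_diff_on k f1 S \<and> cont_diff_on k f2 S)"

definition test_function :: "real \<Rightarrow> (real \<Rightarrow> real \<Rightarrow> real) \<Rightarrow> bool" where
  "test_function T \<phi> \<longleftrightarrow>
     (\<forall>t\<in>{0..<T}. periodic (\<phi> t)) \<and>
     (\<forall>k. cont_diff_on k (\<lambda>(t, x). \<phi> t x) ({0..<T} \<times> UNIV)) \<and>
     (\<exists>T'\<in>{0..<T}. \<forall>t\<in>{T'<..<T}. \<forall>x. \<phi> t x = 0)"

text \<open>The conditions in front of the weak identity express that the expressions occurring in it are
  meaningful: without them, division by \<open>0\<close>, a missing principal value or a
  non-integrable integrand would silently be given some value.\<close>

definition global_weak_solution :: "(real \<Rightarrow> real) \<Rightarrow> (real \<Rightarrow> real \<Rightarrow> real) \<Rightarrow> bool" where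
  "global_weak_solution u0 u \<longleftrightarrow>
     (\<forall>t\<ge>0. periodic (u t)) \<and>
     (\<forall>T>0.
        (\<lambda>(t, x). u t x) absolutely_integrable_on ({0..T} \<times> {0..2*pi}) \<and>
        (AE (t, x) in lebesgue_on ({0..T} \<times> {0..2*pi}). u t x \<noteq> 0 \<and> hilbert_exists (u t) x) \<and>
        (\<lambda>(t, x). flux u t x) absolutely_integrable_on ({0..T} \<times> {0..2*pi}) \<and>
        (\<forall>\<phi>. test_function T \<phi> \<longrightarrow>
           - (LINT s:{0..<T}|lebesgue. LINT x:{0..2*pi}|lebesgue.
                u s x * vector_derivative (\<lambda>\<tau>. \<phi> \<tau> x) (at s within {0..<T}) +
                flux u s x * deriv (\<phi> s) x)
           = (LINT x:{0..2*pi}|lebesgue. u0 x * \<phi> 0 x)))"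

definition Linfty_norm :: "'a measure \<Rightarrow> ('a \<Rightarrow> real) \<Rightarrow> ereal" where
  "Linfty_norm M f = esssup M (\<lambda>x. ereal \<bar>f x\<bar>)"

definition in_Linfty :: "real \<Rightarrow> (real \<Rightarrow> real \<Rightarrow> real) \<Rightarrow> bool" where
  "in_Linfty T u \<longleftrightarrow>
     (\<lambda>(t, x). u t x) \<in> borel_measurable (lebesgue_on ({0..T} \<times> {0..2*pi})) \<and>
     Linfty_norm (lebesgue_on ({0..T} \<times> {0..2*pi})) (\<lambda>(t, x). u t x) < \<infinity>"

text \<open>Joint measurability makes all Fourier coefficients measurable in time, which is Bochner
  measurability in the separable space \<open>H\<^sup>s\<close>.\<close>

definition in_L2_sobolev :: "real \<Rightarrow> real \<Rightarrow> (real \<Rightarrow> real \<Rightarrow> real) \<Rightarrow> bool" where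
  "in_L2_sobolev T s u \<longleftrightarrow>
     (\<lambda>(t, x). u t x) \<in> borel_measurable (lebesgue_on ({0..T} \<times> {0..2*pi})) \<and>
     (AE t in lebesgue_on {0..T}. u t \<in> sobolev_space s) \<and>
     (\<lambda>t. (sobolev_norm s (u t))\<^sup>2) absolutely_integrable_on {0..T}"

end

theory Submission
  imports Defs "HOL-Complex_Analysis.Cauchy_Integral_Formula"
begin

text \<open>Let \<open>F\<close> be the function holomorphic in the unit disc with boundary values \<open>u + \<i> * H u\<close>,
  so that \<open>F t 0\<close> is the mean of the datum and \<open>arctan (H u / u)\<close> is the imaginary part of
  \<open>log F\<close>. The equation becomes \<open>\<partial>\<^sub>t F + w * \<partial>\<^sub>w F / F = 0\<close>, whose solutions are constant
  along the characteristics \<open>w = z * exp (t / F0 z)\<close>. Since \<open>Re (1 / F0) \<ge> \<delta> > 0\<close>, these expand the disc,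
  and for a small datum the map \<open>z \<mapsto> w * exp (- t / F0 z)\<close> is a contraction of the disc of radius
  \<open>exp (- \<delta> * t)\<close>, with constant independent of \<open>t\<close>. Its fixed point \<open>Z t w\<close> gives the solution
  \<open>F t w = F0 (Z t w)\<close>. As \<open>\<bar>Z t w\<bar> \<le> exp (- \<delta> * t)\<close>, the decay is read off the power
  series of \<open>F0\<close>. The \<open>H\<^sup>1\<^sup>/\<^sup>2\<close> norm is bounded by interpolation between \<open>L\<^sup>2\<close> and \<open>H\<^sup>1\<close>, because
  the supremum of \<open>\<partial>\<^sub>x u\<close> is controlled by \<open>\<Sum>n. n * \<bar>b n\<bar> * exp (- n * \<delta> * t)\<close>, which is integrable
  in time.\<close>

section \<open>Bounds for the characteristic flow\<close>

text \<open>A datum in the Wiener space is only continuous on the circle, so \<open>deriv F0\<close>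
  may be unbounded there and the contraction cannot rest on a Lipschitz bound for \<open>F0\<close>
  in the closed unit disc. It has to exploit that the feet lie well inside the disc: the factor n
  lost at frequency n is paid for by t and the decay of the n-th power. The threshold 1/4 is a
  convenient choice. It confines the values of \<open>F0\<close> to the disc of radius m/4 around m,
  whence the rate 4/(5m) and the contraction constant 5/9. For t > 0 the solution is differentiable
  up to the circle and the equation holds classically; at t = 0 only continuity survives. Formulas
  with derivatives or principal values are therefore proved for t > 0, and time 0 is reached by
  continuity or discarded as a null set. The imaginary part on the circle is the Hilbert transform
  because \<open>F t 0\<close> stays real: the centre of the disc is fixed by all
  characteristics.\<close>

lemma norm_power_diff_le:
  fixes z w :: "'a::real_normed_field"
  assumes "norm z \<le> r" "norm w \<le> r"
  shows "norm (z ^ Suc n - w ^ Suc n) \<le> real (Suc n) * r ^ n * norm (z - w)"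
proof (induction n)
  case (Suc n)
  have r: "0 \<le> r"
    using assms(1) norm_ge_zero order_trans by blast
  have "z ^ Suc (Suc n) - w ^ Suc (Suc n) = z * (z ^ Suc n - w ^ Suc n) + (z - w) * w ^ Suc n"
    by (simp add: algebra_simps)
  also have "norm \<dots> \<le> norm z * norm (z ^ Suc n - w ^ Suc n) + norm (z - w) * norm w ^ Suc n"
    using norm_triangle_ineq[of "z * (z ^ Suc n - w ^ Suc n)" "(z - w) * w ^ Suc n"]
    by (simp only: norm_mult norm_power)
  also have "\<dots> \<le> r * (real (Suc n) * r ^ n * norm (z - w)) + norm (z - w) * r ^ Suc n"
    using Suc assms r by (intro add_mono mult_mono power_mono) auto
  finally show ?case
    by (simp add: algebra_simps)
qed simp

text \<open>Mean value inequality on a half-plane, which is convex and on which the derivative of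
  \<open>exp\<close> has modulus at most \<open>exp a\<close>. With
  \<open>a = - (\<delta> * t)\<close> this factor is the decay that the contraction needs.\<close>

lemma norm_exp_diff_le:
  fixes z w :: complex
  assumes "Re z \<le> a" "Re w \<le> a"
  shows "norm (exp z - exp w) \<le> exp a * norm (z - w)"
proof (rule field_differentiable_bound[where S = "{z. Re z \<le> a}" and f' = exp])
  show "convex {z. Re z \<le> a}"
    by (rule convex_halfspace_Re_le)
qed (use assms in \<open>auto intro!: derivative_eq_intros\<close>)

lemma mult_exp_minus_le:
  fixes s d :: real
  assumes "d > 0"
  shows "s * exp (- (d * s)) \<le> 1 / d"
proof -
  have "d * s \<le> exp (d * s)"
    using exp_ge_add_one_self[of "d * s"] by linarith
  then show ?thesis
    using assms by (simp add: exp_minus field_simps)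
qed

text \<open>Sequences of coefficients are indexed so that \<open>b n\<close> belongs to the frequency \<open>n + 1\<close>.\<close>

locale small_datum =
  fixes m \<beta> :: real and b :: "nat \<Rightarrow> complex"
  assumes m_pos: "m > 0" and b_sums: "(\<lambda>n. norm (b n)) sums \<beta>" and small: "\<beta> \<le> m / 4"
begin

definition F0 :: "complex \<Rightarrow> complex" where
  "F0 z = of_real m + (\<Sum>n. b n * z ^ Suc n)"

definition \<delta> :: real where "\<delta> = 4 / (5 * m)"

definition radius :: "real \<Rightarrow> real" where "radius t = exp (- (\<delta> * t))"

lemma \<delta>_pos: "\<delta> > 0"
  using m_pos by (simp add: \<delta>_def)

lemma \<beta>_nonneg: "0 \<le> \<beta>"
  using sums_le[OF _ sums_zero b_sums] by simp

lemma radius_pos: "0 < radius t"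
  by (simp add: radius_def)

lemma radius_le_1: "0 \<le> t \<Longrightarrow> radius t \<le> 1"
  using \<delta>_pos by (simp add: radius_def)

lemma radius_less_1: "0 < t \<Longrightarrow> radius t < 1"
  using \<delta>_pos by (simp add: radius_def)

lemma radius_antimono: "s \<le> t \<Longrightarrow> radius t \<le> radius s"
  using \<delta>_pos by (simp add: radius_def)

lemma summable_b: "summable (\<lambda>n. norm (b n))"
  using b_sums by (rule sums_summable)

lemma norm_term_le: "norm z \<le> 1 \<Longrightarrow> norm (b n * z ^ k) \<le> norm (b n)"
  by (simp add: norm_mult norm_power mult_left_le power_le_one)

lemma summable_norm_F0: "norm z \<le> 1 \<Longrightarrow> summable (\<lambda>n. norm (b n * z ^ Suc n))"
  by (rule summable_comparison_test'[OF summable_b]) (use norm_term_le[of z] in \<open>simp del: power_Suc\<close>)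

lemma summable_F0: "norm z \<le> 1 \<Longrightarrow> summable (\<lambda>n. b n * z ^ Suc n)"
  using summable_norm_F0 by (rule summable_norm_cancel)

lemma F0_0: "F0 0 = of_real m"
  by (simp add: F0_def)

text \<open>Every power in the series has exponent at least 1, so a factor r comes out of each term.
  For \<open>r = radius t\<close> this is the exponential decay.\<close>

lemma norm_F0_minus_mean_le:
  assumes "norm z \<le> r" "r \<le> 1"
  shows "norm (F0 z - of_real m) \<le> \<beta> * r"
proof -
  have r: "0 \<le> r"
    using assms(1) norm_ge_zero order_trans by blast
  have z: "norm z \<le> 1"
    using assms by linarith
  have "norm (F0 z - of_real m) = norm (\<Sum>n. b n * z ^ Suc n)"
    by (simp add: F0_def)
  also have "\<dots> \<le> (\<Sum>n. norm (b n * z ^ Suc n))"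
    by (rule summable_norm[OF summable_norm_F0[OF z]])
  also have "\<dots> \<le> (\<Sum>n. norm (b n) * r)"
  proof (rule suminf_le)
    fix n
    have "norm z ^ Suc n \<le> norm z"
      using z by (simp add: mult_left_le power_le_one)
    then show "norm (b n * z ^ Suc n) \<le> norm (b n) * r"
      using assms by (auto simp: norm_mult norm_power intro!: mult_left_mono)
  qed (use summable_norm_F0[OF z] summable_b in \<open>auto intro: summable_mult2\<close>)
  also have "\<dots> = \<beta> * r"
    using sums_unique[OF sums_mult2[OF b_sums, of r]] by simp
  finally show ?thesis .
qed

lemma norm_F0_minus_mean_le':
  assumes "norm z \<le> 1"
  shows "norm (F0 z - of_real m) \<le> m / 4"
  using norm_F0_minus_mean_le[OF assms] small by simp

lemma Re_F0_ge: "norm z \<le> 1 \<Longrightarrow> 3 / 4 * m \<le> Re (F0 z)"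
  using norm_F0_minus_mean_le'[of z] abs_Re_le_cmod[of "F0 z - of_real m"] by simp

lemma norm_F0_ge: "norm z \<le> 1 \<Longrightarrow> 3 / 4 * m \<le> norm (F0 z)"
  using Re_F0_ge complex_Re_le_cmod order_trans by blast

lemma F0_nonzero: "norm z \<le> 1 \<Longrightarrow> F0 z \<noteq> 0"
  using norm_F0_ge m_pos by fastforce

lemma norm_F0_le: "norm z \<le> 1 \<Longrightarrow> norm (F0 z) \<le> 2 * m"
  using norm_F0_minus_mean_le'[of z] norm_triangle_sub[of "F0 z" "of_real m"] m_pos by simp

text \<open>Inversion maps the disc of radius \<open>m / 4\<close> around \<open>m\<close> to a disc whose leftmost point is
  \<open>4 / (5 * m)\<close>.\<close>

lemma Re_inverse_F0_ge:
  assumes "norm z \<le> 1"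
  shows "\<delta> \<le> Re (1 / F0 z)"
proof -
  define x y where "x = Re (F0 z)" and "y = Im (F0 z)"
  have "(norm (F0 z - of_real m))\<^sup>2 \<le> (m / 4)\<^sup>2"
    using norm_F0_minus_mean_le'[OF assms] by (intro power_mono) auto
  then have disc: "(x - m)\<^sup>2 + y\<^sup>2 \<le> (m / 4)\<^sup>2"
    by (simp add: cmod_power2 x_def y_def)
  have x: "x \<le> 5 / 4 * m" "x > 0"
    using norm_F0_minus_mean_le'[OF assms] abs_Re_le_cmod[of "F0 z - of_real m"] m_pos
    by (auto simp: x_def)
  have "4 * (x\<^sup>2 + y\<^sup>2) \<le> 5 * m * x"
  proof -
    have "4 * (x\<^sup>2 + y\<^sup>2) \<le> 4 * (m\<^sup>2 / 16 + 2 * m * x - m\<^sup>2)"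
      using disc by (simp add: power2_eq_square algebra_simps)
    also have "\<dots> = 5 * m * x - 3 * m * (5 / 4 * m - x)"
      by (simp add: power2_eq_square algebra_simps)
    also have "\<dots> \<le> 5 * m * x"
      using x m_pos by simp
    finally show ?thesis .
  qed
  moreover have "x\<^sup>2 + y\<^sup>2 > 0"
    using x(2) by (simp add: add_pos_nonneg)
  ultimately have "\<delta> \<le> x / (x\<^sup>2 + y\<^sup>2)"
    using m_pos by (simp add: \<delta>_def field_simps)
  then show ?thesis
    by (simp add: x_def y_def Re_divide)
qed

lemma norm_inverse_F0_diff_le:
  assumes "norm z \<le> 1" "norm w \<le> 1"
  shows "norm (1 / F0 z - 1 / F0 w) \<le> norm (F0 z - F0 w) * (16 / (9 * m\<^sup>2))"
proof -
  have "(3 / 4 * m) * (3 / 4 * m) \<le> norm (F0 z) * norm (F0 w)"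
    using norm_F0_ge[OF assms(1)] norm_F0_ge[OF assms(2)] m_pos by (intro mult_mono) auto
  then have le: "9 * m\<^sup>2 / 16 \<le> norm (F0 z) * norm (F0 w)"
    by (simp add: power2_eq_square)
  have "norm (1 / F0 z - 1 / F0 w) = norm (F0 z - F0 w) / (norm (F0 z) * norm (F0 w))"
    using F0_nonzero[OF assms(1)] F0_nonzero[OF assms(2)]
    by (simp add: diff_frac_eq norm_divide norm_mult norm_minus_commute)
  also have "\<dots> \<le> norm (F0 z - F0 w) / (9 * m\<^sup>2 / 16)"
    using le m_pos F0_nonzero assms by (intro divide_left_mono) auto
  finally show ?thesis
    by simp
qed

text \<open>Comparison with the differentiated geometric series. The sum majorises the series of
  \<open>deriv F0\<close> on the disc of radius r; at r = 1 it may diverge.\<close>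

lemma summable_speed:
  assumes "0 \<le> r" "r < 1"
  shows "summable (\<lambda>n. norm (b n) * (real (Suc n) * r ^ n))"
proof -
  have "summable (\<lambda>n. diffs (\<lambda>_. 1) n * r ^ n)"
    by (rule termdiff_converges[where K = 1]) (use assms in \<open>auto intro: summable_geometric\<close>)
  then have *: "summable (\<lambda>n. \<beta> * (real (Suc n) * r ^ n))"
    by (intro summable_mult) (simp add: diffs_def)
  have "norm (b n) \<le> \<beta>" for n
    using sum_le_suminf[OF summable_b, of "{n}"] sums_unique[OF b_sums] by simp
  then show ?thesis
    using assms by (intro summable_comparison_test'[OF *]) (auto intro!: mult_right_mono)
qed

lemma norm_F0_diff_le:
  assumes "norm z \<le> r" "norm w \<le> r" "r < 1"
  shows "norm (F0 z - F0 w) \<le> (\<Sum>n. norm (b n) * (real (Suc n) * r ^ n)) * norm (z - w)"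
proof -
  have r: "0 \<le> r"
    using assms(1) norm_ge_zero order_trans by blast
  have zw: "norm z \<le> 1" "norm w \<le> 1"
    using assms by linarith+
  have le: "norm (b n * z ^ Suc n - b n * w ^ Suc n)
      \<le> norm (b n) * (real (Suc n) * r ^ n) * norm (z - w)" for n
    using mult_left_mono[OF norm_power_diff_le[OF assms(1,2)], of "norm (b n)" n]
    by (simp only: flip: norm_mult right_diff_distrib) (simp only: norm_ge_zero mult.assoc)
  note summable = summable_mult2[OF summable_speed[OF r assms(3)], of "norm (z - w)"]
  have "F0 z - F0 w = (\<Sum>n. b n * z ^ Suc n - b n * w ^ Suc n)"
    by (simp only: F0_def suminf_diff[OF summable_F0[OF zw(1)] summable_F0[OF zw(2)], symmetric]) simp
  also have "norm \<dots> \<le> (\<Sum>n. norm (b n) * (real (Suc n) * r ^ n) * norm (z - w))"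
    by (rule norm_suminf_le[OF le summable])
  also have "\<dots> = (\<Sum>n. norm (b n) * (real (Suc n) * r ^ n)) * norm (z - w)"
    by (rule suminf_mult2[OF summable_speed[OF r assms(3)], symmetric])
  finally show ?thesis .
qed

text \<open>The exponential factor compensates the loss of a derivative, since
  \<open>t * n * exp (- n * \<delta> * t) \<le> 1 / \<delta>\<close>.\<close>

lemma weighted_F0_diff_le:
  assumes "t \<ge> 0" "norm z \<le> radius t" "norm w \<le> radius t"
  shows "t * radius t * norm (F0 z - F0 w) \<le> \<beta> / \<delta> * norm (z - w)"
proof (cases "t = 0")
  case True
  then show ?thesis
    using \<beta>_nonneg \<delta>_pos by simp
next
  case False
  then have r: "radius t < 1" "0 \<le> radius t"
    using assms radius_less_1 radius_pos[of t] by auto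
  have "t * radius t * (\<Sum>n. norm (b n) * (real (Suc n) * radius t ^ n))
      = (\<Sum>n. t * radius t * (norm (b n) * (real (Suc n) * radius t ^ n)))"
    by (rule suminf_mult[OF summable_speed[OF r(2,1)], symmetric])
  also have "\<dots> \<le> (\<Sum>n. norm (b n) * (1 / \<delta>))"
  proof (rule suminf_le)
    fix n
    have "t * real (Suc n) * radius t ^ Suc n \<le> 1 / \<delta>"
      using mult_exp_minus_le[OF \<delta>_pos, of "real (Suc n) * t"]
      by (simp add: radius_def exp_of_nat_mult[symmetric] mult_ac del: of_nat_Suc power_Suc)
    from mult_left_mono[OF this, of "norm (b n)"]
    show "t * radius t * (norm (b n) * (real (Suc n) * radius t ^ n)) \<le> norm (b n) * (1 / \<delta>)"
      by (simp add: mult_ac)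
  qed (use summable_speed[OF r(2,1)] summable_b in \<open>auto intro: summable_mult summable_mult2 simp del: of_nat_Suc\<close>)
  also have "\<dots> = \<beta> / \<delta>"
    using sums_unique[OF sums_mult2[OF b_sums, of "1 / \<delta>"]] by simp
  finally have *: "t * radius t * (\<Sum>n. norm (b n) * (real (Suc n) * radius t ^ n)) \<le> \<beta> / \<delta>" .
  have "t * radius t * norm (F0 z - F0 w)
      \<le> t * radius t * ((\<Sum>n. norm (b n) * (real (Suc n) * radius t ^ n)) * norm (z - w))"
    using norm_F0_diff_le[OF assms(2,3) r(1)] assms(1) r(2) by (intro mult_left_mono) auto
  also have "\<dots> \<le> \<beta> / \<delta> * norm (z - w)"
    using mult_right_mono[OF *, of "norm (z - w)"] by (simp add: mult.assoc)
  finally show ?thesis .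
qed

section \<open>The fixed-point map and the feet of the characteristics\<close>

definition K :: "real \<Rightarrow> complex \<Rightarrow> complex" where
  "K t z = exp (- (of_real t / F0 z))"

lemma Re_exponent: "Re (of_real t / F0 z) = t * Re (1 / F0 z)"
  by (simp add: Re_divide)

lemma norm_K_le:
  assumes "t \<ge> 0" "norm z \<le> 1"
  shows "norm (K t z) \<le> radius t"
proof -
  have "norm (K t z) = exp (- (t * Re (1 / F0 z)))"
    by (simp add: K_def norm_exp_eq_Re Re_exponent)
  also have "\<dots> \<le> radius t"
    using mult_left_mono[OF Re_inverse_F0_ge[OF assms(2)] assms(1)]
    by (simp add: radius_def mult.commute)
  finally show ?thesis .
qed

text \<open>\<open>norm_exp_diff_le\<close> contributes \<open>radius t\<close>, which together with
  t absorbs the increment of \<open>F0\<close> by \<open>weighted_F0_diff_le\<close>; inversion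
  costs \<open>16 / (9 * m\<^sup>2)\<close>. Inserting the value of \<delta> and
  \<open>\<beta> \<le> m / 4\<close> gives 5/9 for every t.\<close>

lemma norm_K_diff_space_le:
  assumes "t \<ge> 0" "norm z \<le> radius t" "norm w \<le> radius t"
  shows "norm (K t z - K t w) \<le> 5 / 9 * norm (z - w)"
proof -
  have zw: "norm z \<le> 1" "norm w \<le> 1"
    using assms radius_le_1 by (meson order_trans)+
  have Re: "Re (- (of_real t / F0 z)) \<le> - (\<delta> * t)" if "norm z \<le> 1" for z
    using mult_left_mono[OF Re_inverse_F0_ge[OF that] assms(1)] by (simp add: Re_exponent mult.commute)
  have "norm (K t z - K t w)
      \<le> radius t * norm (- (of_real t / F0 z) - - (of_real t / F0 w))"
    unfolding K_def radius_def by (rule norm_exp_diff_le[OF Re[OF zw(1)] Re[OF zw(2)]])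
  also have "- (of_real t / F0 z) - - (of_real t / F0 w) = of_real t * (1 / F0 w - 1 / F0 z)"
    by (simp add: algebra_simps)
  also have "radius t * norm (of_real t * (1 / F0 w - 1 / F0 z)) =
      t * radius t * norm (1 / F0 z - 1 / F0 w)"
    using assms(1) by (simp only: norm_mult norm_of_real norm_minus_commute) simp
  also have "\<dots> \<le> t * radius t * (norm (F0 z - F0 w) * (16 / (9 * m\<^sup>2)))"
    using norm_inverse_F0_diff_le[OF zw] assms(1) radius_pos[of t] by (intro mult_left_mono) auto
  also have "\<dots> \<le> \<beta> / \<delta> * norm (z - w) * (16 / (9 * m\<^sup>2))"
    using mult_right_mono[OF weighted_F0_diff_le[OF assms], of "16 / (9 * m\<^sup>2)"]
    by (simp add: mult.assoc)
  also have "\<dots> = \<beta> * (20 / (9 * m)) * norm (z - w)"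
    using m_pos by (simp add: \<delta>_def power2_eq_square)
  also have "\<dots> \<le> (m / 4) * (20 / (9 * m)) * norm (z - w)"
    using small m_pos by (intro mult_right_mono) auto
  also have "\<dots> = 5 / 9 * norm (z - w)"
    using m_pos by simp
  finally show ?thesis .
qed

lemma norm_K_diff_time_le:
  assumes "t \<ge> 0" "s \<ge> 0" "norm z \<le> 1"
  shows "norm (K t z - K s z) \<le> 4 / (3 * m) * \<bar>t - s\<bar>"
proof -
  have Re: "Re (- (of_real t / F0 z)) \<le> 0" if "t \<ge> 0" for t
    using mult_nonneg_nonneg[OF that order_trans[OF less_imp_le[OF \<delta>_pos] Re_inverse_F0_ge[OF assms(3)]]]
    by (simp add: Re_exponent)
  have "norm (K t z - K s z) \<le> exp 0 * norm (- (of_real t / F0 z) - - (of_real s / F0 z))"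
    unfolding K_def by (rule norm_exp_diff_le[OF Re[OF assms(1)] Re[OF assms(2)]])
  also have "- (of_real t / F0 z) - - (of_real s / F0 z) = of_real (s - t) / F0 z"
    by (simp add: diff_divide_distrib)
  also have "exp 0 * norm (of_real (s - t) / F0 z) = \<bar>t - s\<bar> / norm (F0 z)"
    by (simp only: norm_divide norm_of_real) (simp add: abs_minus_commute)
  also have "\<dots> \<le> \<bar>t - s\<bar> / (3 / 4 * m)"
    using norm_F0_ge[OF assms(3)] m_pos by (intro divide_left_mono mult_pos_pos) auto
  finally show ?thesis
    by simp
qed

text \<open>\<open>Z t w\<close> is the foot at time \<open>0\<close> of the characteristic through \<open>w\<close> at time \<open>t\<close>.\<close>

definition Z :: "real \<Rightarrow> complex \<Rightarrow> complex" where
  "Z t w = (THE z. norm z \<le> radius t \<and> w * K t z = z)"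

text \<open>Banach's theorem on the closed disc of radius \<open>radius t\<close>:
  \<open>norm_K_le\<close> makes it invariant, and the contraction estimate is valid there.\<close>

lemma Z_props:
  assumes "t \<ge> 0" "norm w \<le> 1"
  shows norm_Z_le: "norm (Z t w) \<le> radius t"
    and Z_fix: "w * K t (Z t w) = Z t w"
    and Z_unique: "norm z \<le> radius t \<Longrightarrow> w * K t z = z \<Longrightarrow> z = Z t w"
proof -
  have "\<exists>!z\<in>cball 0 (radius t). w * K t z = z"
  proof (rule Banach_fix[of _ "5 / 9"])
    show "(\<lambda>z. w * K t z) ` cball 0 (radius t) \<subseteq> cball 0 (radius t)"
    proof safe
      fix z assume "z \<in> cball (0::complex) (radius t)"
      then have "norm (K t z) \<le> radius t"
        using assms radius_le_1[of t] by (intro norm_K_le) auto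
      then have "norm (w * K t z) \<le> 1 * radius t"
        unfolding norm_mult using assms by (intro mult_mono) auto
      then show "w * K t z \<in> cball 0 (radius t)"
        by simp
    qed
    fix z z' assume "z \<in> cball (0::complex) (radius t)" "z' \<in> cball (0::complex) (radius t)"
    then have "norm (K t z - K t z') \<le> 5 / 9 * norm (z - z')"
      using assms by (intro norm_K_diff_space_le) auto
    then have "norm w * norm (K t z - K t z') \<le> 1 * (5 / 9 * norm (z - z'))"
      using assms by (intro mult_mono) auto
    then show "dist (w * K t z) (w * K t z') \<le> 5 / 9 * dist z z'"
      by (simp add: dist_norm norm_mult flip: right_diff_distrib)
  qed (use radius_pos[of t] in \<open>auto simp: complete_eq_closed\<close>)
  then have ex1: "\<exists>!z. norm z \<le> radius t \<and> w * K t z = z"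
    by (auto simp: Bex_def Ex1_def)
  show "norm (Z t w) \<le> radius t" "w * K t (Z t w) = Z t w"
    using theI'[OF ex1] unfolding Z_def by auto
  show "z = Z t w" if "norm z \<le> radius t" "w * K t z = z"
    using the1_equality[OF ex1, of z] that unfolding Z_def by auto
qed

lemma norm_Z_le_1: "t \<ge> 0 \<Longrightarrow> norm w \<le> 1 \<Longrightarrow> norm (Z t w) \<le> 1"
  using norm_Z_le radius_le_1 order_trans by blast

lemma Z_zero: "t \<ge> 0 \<Longrightarrow> Z t 0 = 0"
  using Z_unique[of t 0 0] radius_pos[of t] by simp

lemma Z_initial: "norm w \<le> 1 \<Longrightarrow> Z 0 w = w"
  using Z_unique[of 0 w w] by (simp add: radius_def K_def)

text \<open>Subtracting the two fixed-point equations leaves 5/9 of the difference on the right;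
  absorbing it gives the factor \<open>1 / (1 - 5 / 9) = 9 / 4\<close>. The factor
  \<open>radius t\<close> comes from the explicit dependence on w.\<close>

lemma Z_lipschitz_space:
  assumes "t \<ge> 0" "norm w \<le> 1" "norm w' \<le> 1"
  shows "norm (Z t w - Z t w') \<le> 9 / 4 * radius t * norm (w - w')"
proof -
  let ?z = "Z t w" and ?z' = "Z t w'"
  have "?z - ?z' = (w - w') * K t ?z + w' * (K t ?z - K t ?z')"
    using Z_fix[OF assms(1,2)] Z_fix[OF assms(1,3)] by (simp add: algebra_simps)
  then have "norm (?z - ?z') \<le> norm (w - w') * norm (K t ?z) + norm w' * norm (K t ?z - K t ?z')"
    using norm_triangle_ineq[of "(w - w') * K t ?z" "w' * (K t ?z - K t ?z')"] by (simp only: norm_mult)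
  also have "\<dots> \<le> norm (w - w') * radius t + 1 * (5 / 9 * norm (?z - ?z'))"
    using assms norm_K_le[OF assms(1) norm_Z_le_1] norm_K_diff_space_le[OF assms(1) norm_Z_le norm_Z_le]
    by (intro add_mono mult_mono) auto
  finally show ?thesis
    by (simp add: algebra_simps)
qed

text \<open>For t \<le> s the later foot also lies in the larger disc of radius
  \<open>radius t\<close>, so the contraction at time t applies to both feet. The constant is 9/4
  times the bound 4/(3m) for the modulus of \<open>1 / F0\<close>.\<close>

lemma Z_lipschitz_time:
  assumes "0 \<le> t" "t \<le> s" "norm w \<le> 1"
  shows "norm (Z t w - Z s w) \<le> 3 / m * (s - t)"
proof -
  let ?z = "Z t w" and ?z' = "Z s w"
  have s: "s \<ge> 0"
    using assms by simp
  have "norm ?z' \<le> radius t"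
    using norm_Z_le[OF s assms(3)] radius_antimono[OF assms(2)] by linarith
  note K = norm_K_diff_space_le[OF assms(1) norm_Z_le[OF assms(1,3)] this]
  have "?z - ?z' = w * (K t ?z - K t ?z') + w * (K t ?z' - K s ?z')"
    using Z_fix[OF assms(1,3)] Z_fix[OF s assms(3)] by (simp add: algebra_simps)
  then have "norm (?z - ?z') \<le> norm w * norm (K t ?z - K t ?z') + norm w * norm (K t ?z' - K s ?z')"
    using norm_triangle_ineq[of "w * (K t ?z - K t ?z')" "w * (K t ?z' - K s ?z')"] by (simp only: norm_mult)
  also have "\<dots> \<le> 1 * (5 / 9 * norm (?z - ?z')) + 1 * (4 / (3 * m) * \<bar>t - s\<bar>)"
    using assms s K norm_K_diff_time_le[OF assms(1) s norm_Z_le_1[OF s]]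
    by (intro add_mono mult_mono) auto
  finally have "norm (?z - ?z') \<le> 5 / 9 * norm (?z - ?z') + 4 / (3 * m) * (s - t)"
    using assms by (simp only: mult_1_left abs_minus_commute[of t s] abs_of_nonneg)
  then have "norm (?z - ?z') \<le> 9 / 4 * (4 / (3 * m) * (s - t))"
    by linarith
  also have "\<dots> = 3 / m * (s - t)"
    using m_pos by (simp add: field_simps)
  finally show ?thesis .
qed

lemma continuous_on_Z: "continuous_on ({0..} \<times> cball 0 1) (\<lambda>(t, w). Z t w)"
proof -
  have *: "norm (Z t w - Z s w) \<le> 3 / m * \<bar>t - s\<bar>" if "t \<ge> 0" "s \<ge> 0" "norm w \<le> 1" for t s w
    using Z_lipschitz_time[of t s w] Z_lipschitz_time[of s t w] that
    by (cases "t \<le> s") (auto simp: norm_minus_commute)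
  have "((\<lambda>(t, w). Z t w) \<longlongrightarrow> Z t0 w0) (at (t0, w0) within {0..} \<times> cball 0 1)"
    if "t0 \<ge> 0" "norm w0 \<le> 1" for t0 w0
  proof (rule Lim_null_comparison[THEN LIM_zero_cancel])
    show "((\<lambda>(t, w). 3 / m * \<bar>t - t0\<bar> + 9 / 4 * radius t0 * norm (w - w0)) \<longlongrightarrow> 0)
        (at (t0, w0) within {0..} \<times> cball 0 1)"
      unfolding split_beta using m_pos by (auto intro!: tendsto_eq_intros)
    have "norm (Z t w - Z t0 w0) \<le> 3 / m * \<bar>t - t0\<bar> + 9 / 4 * radius t0 * norm (w - w0)"
      if "t \<ge> 0" "norm w \<le> 1" for t w
      using norm_triangle_ineq[of "Z t w - Z t0 w" "Z t0 w - Z t0 w0"] *[of t t0 w]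
        Z_lipschitz_space[of t0 w w0] that \<open>t0 \<ge> 0\<close> \<open>norm w0 \<le> 1\<close> by simp
    then show "\<forall>\<^sub>F p in at (t0, w0) within {0..} \<times> cball 0 1.
        norm ((case p of (t, w) \<Rightarrow> Z t w) - Z t0 w0)
        \<le> (case p of (t, w) \<Rightarrow> 3 / m * \<bar>t - t0\<bar> + 9 / 4 * radius t0 * norm (w - w0))"
      by (auto simp: eventually_at_filter split_beta intro!: always_eventually)
  qed
  then show ?thesis
    by (force simp: continuous_on_def)
qed

section \<open>Regularity of \<open>F0\<close> in the closed and in the open disc\<close>

lemma uniform_limit_F0:
  "uniform_limit (cball 0 1) (\<lambda>n z. \<Sum>i<n. b i * z ^ Suc i) (\<lambda>z. F0 z - of_real m) sequentially"
  unfolding F0_def add_diff_cancel_left'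
  by (rule Weierstrass_m_test[OF _ summable_b]) (auto intro: norm_term_le simp del: power_Suc)

lemma continuous_on_F0: "continuous_on (cball 0 1) F0"
proof -
  have "continuous_on (cball 0 1) (\<lambda>z. F0 z - of_real m)"
    by (rule uniform_limit_theorem[OF _ uniform_limit_F0])
       (auto intro!: always_eventually continuous_intros simp del: power_Suc)
  from continuous_on_add[OF this continuous_on_const[of _ "of_real m"]] show ?thesis
    by simp
qed

lemma holomorphic_on_F0: "F0 holomorphic_on ball 0 1"
proof -
  define g where "g z = (\<Sum>n. b n * z ^ n)" for z
  have summable: "summable (\<lambda>n. b n * z ^ n)" if "norm z < 1" for z
    using that by (intro summable_norm_cancel[OF summable_comparison_test'[OF summable_b]])
      (auto intro!: norm_term_le)
  have "g holomorphic_on ball 0 1"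
    by (rule power_series_holomorphic[where a = b]) (use summable in \<open>auto simp: g_def intro: summable_sums\<close>)
  then have "(\<lambda>z. of_real m + z * g z) holomorphic_on ball 0 1"
    by (intro holomorphic_intros)
  then show ?thesis
  proof (rule holomorphic_transform)
    fix z :: complex assume "z \<in> ball 0 1"
    then show "of_real m + z * g z = F0 z"
      using suminf_mult[OF summable, of z z] by (simp add: F0_def g_def mult_ac)
  qed
qed

end

section \<open>Derivatives along the flow\<close>

text \<open>The quotient form lets one implicit differentiation, with complex increments, serve both
  the real time derivative and the complex space derivative.\<close>

lemma has_vector_derivative_complex_quotient:
  fixes g :: "real \<Rightarrow> complex"
  assumes "((\<lambda>s. (g s - g t) / of_real (s - t)) \<longlongrightarrow> D) (at t within S)"
  shows "(g has_vector_derivative D) (at t within S)"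
proof -
  have "((\<lambda>s. norm ((g s - g t) / of_real (s - t) - D)) \<longlongrightarrow> 0) (at t within S)"
    using assms by (intro tendsto_norm_zero LIM_zero)
  moreover have "\<forall>\<^sub>F s in at t within S. norm ((g s - g t) / of_real (s - t) - D)
      = norm (g s - g t - (s - t) *\<^sub>R D) / norm (s - t)"
  proof (intro eventually_at_filter[THEN iffD2] always_eventually allI impI)
    fix s assume "s \<noteq> t"
    then have "(g s - g t) / of_real (s - t) - D = (g s - g t - (s - t) *\<^sub>R D) / of_real (s - t)"
      by (simp add: field_simps scaleR_conv_of_real del: of_real_diff)
    then show "norm ((g s - g t) / of_real (s - t) - D)
        = norm (g s - g t - (s - t) *\<^sub>R D) / norm (s - t)"
      by (simp only: norm_divide norm_of_real real_norm_def)
  qed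
  ultimately show ?thesis
    unfolding has_vector_derivative_def has_derivative_iff_norm
    by (auto simp: tendsto_cong intro: bounded_linear_scaleR_left)
qed

text \<open>Working within S admits boundary points of discs: a foot may lie on the circle of radius
  \<open>radius t\<close>, and w on the unit circle.\<close>

lemma norm_deriv_le_of_lipschitz:
  fixes f :: "complex \<Rightarrow> complex"
  assumes "(f has_field_derivative D) (at z within S)" "at z within S \<noteq> bot" "z \<in> S"
    and lip: "\<And>w. w \<in> S \<Longrightarrow> norm (f w - f z) \<le> c * norm (w - z)"
  shows "norm D \<le> c"
proof (rule tendsto_upperbound[OF tendsto_norm[OF assms(1)[unfolded has_field_derivative_iff]] _ assms(2)])
  show "\<forall>\<^sub>F w in at z within S. norm ((f w - f z) / (w - z)) \<le> c"
    using lip by (auto simp: eventually_at_filter norm_divide divide_le_eq intro!: always_eventually)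
qed

text \<open>Implicit differentiation of \<open>g p = A p (g p)\<close>: \<open>N\<close> collects the explicit dependence on
  the parameter, and \<open>d\<close> is the increment of the parameter.\<close>

lemma tendsto_implicit_quotient:
  fixes g N d :: "'a \<Rightarrow> complex"
  assumes k: "(k has_field_derivative k') (at z0)"
    and lim: "(g \<longlongrightarrow> z0) F"
    and eq: "\<forall>\<^sub>F p in F. g p - z0 = N p + a * (k (g p) - k z0)"
    and ne: "1 - a * k' \<noteq> 0"
    and N: "((\<lambda>p. N p / d p) \<longlongrightarrow> n) F"
  shows "((\<lambda>p. (g p - z0) / d p) \<longlongrightarrow> n / (1 - a * k')) F"
proof -
  \<comment> \<open>Caratheodory's slope function replaces the difference quotient of
    \<open>k\<close>, which would be undefined whenever \<open>g p = z0\<close>.\<close>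
  obtain R where R: "\<And>z. k z - k z0 = R z * (z - z0)" "isCont R z0" "R z0 = k'"
    using k unfolding DERIV_caratheodory_within by blast
  have Rg: "((\<lambda>p. 1 - a * R (g p)) \<longlongrightarrow> 1 - a * k') F"
    using isCont_tendsto_compose[OF R(2) lim] R(3) by (auto intro!: tendsto_intros)
  then have "\<forall>\<^sub>F p in F. 1 - a * R (g p) \<noteq> 0"
    using ne by (rule tendsto_imp_eventually_ne)
  with eq have "\<forall>\<^sub>F p in F. N p / d p / (1 - a * R (g p)) = (g p - z0) / d p"
  proof eventually_elim
    case (elim p)
    then have "N p = (g p - z0) * (1 - a * R (g p))"
      using R(1)[of "g p"] by (simp add: algebra_simps)
    then have "N p / d p / (1 - a * R (g p)) = (g p - z0) * (1 - a * R (g p)) / d p / (1 - a * R (g p))"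
      by (simp only:)
    then show ?case
      using elim(2) by simp
  qed
  then show ?thesis
    using tendsto_divide[OF N Rg ne] by (rule Lim_transform_eventually[rotated])
qed

text \<open>The slope p varies along the filter, as \<open>- 1 / F0 (Z s w)\<close> does with s, so
  the derivative of \<open>exp\<close> along a fixed direction would not do; only the limit of p
  enters.\<close>

lemma tendsto_exp_quotient:
  fixes h p :: "'a \<Rightarrow> complex"
  assumes "(h \<longlongrightarrow> 0) F" "(p \<longlongrightarrow> l) F" "\<forall>\<^sub>F x in F. h x \<noteq> 0"
  shows "((\<lambda>x. (exp (h x * p x) - 1) / h x) \<longlongrightarrow> l) F"
proof -
  obtain E where E: "\<And>z. exp z - exp 0 = E z * (z - 0)" "isCont E (0::complex)" "E 0 = exp 0"
    using DERIV_exp[of "0::complex"] unfolding DERIV_caratheodory_within by blast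
  have "((\<lambda>x. h x * p x) \<longlongrightarrow> 0) F"
    using tendsto_mult[OF assms(1,2)] by simp
  from tendsto_mult[OF isCont_tendsto_compose[OF E(2) this] assms(2)]
  have "((\<lambda>x. E (h x * p x) * p x) \<longlongrightarrow> l) F"
    by (simp add: E(3))
  moreover have "\<forall>\<^sub>F x in F. E (h x * p x) * p x = (exp (h x * p x) - 1) / h x"
    using assms(3) by eventually_elim (use E(1) in simp)
  ultimately show ?thesis
    by (rule Lim_transform_eventually)
qed

section \<open>The transported function in the closed disc\<close>

context small_datum
begin

definition F :: "real \<Rightarrow> complex \<Rightarrow> complex" where "F t w = F0 (Z t w)"

text \<open>The derivative of the characteristic map \<open>z \<mapsto> z * exp (t / F0 z)\<close> at \<open>Z t w\<close> is
  \<open>J t w / K t (Z t w)\<close>.\<close>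

definition J :: "real \<Rightarrow> complex \<Rightarrow> complex" where
  "J t w = 1 - Z t w * (of_real t * deriv F0 (Z t w) / (F0 (Z t w))\<^sup>2)"

lemma norm_Z_less_1: "t > 0 \<Longrightarrow> norm w \<le> 1 \<Longrightarrow> norm (Z t w) < 1"
  using norm_Z_le[of t w] radius_less_1[of t] by simp

lemma F0_has_field_derivative:
  "norm z < 1 \<Longrightarrow> (F0 has_field_derivative deriv F0 z) (at z)"
  by (intro holomorphic_derivI[OF holomorphic_on_F0]) auto

lemma isCont_F0: "norm z < 1 \<Longrightarrow> isCont F0 z"
  using F0_has_field_derivative DERIV_isCont by blast

lemma K_has_field_derivative:
  assumes "norm z < 1"
  shows "(K t has_field_derivative K t z * (of_real t * deriv F0 z / (F0 z)\<^sup>2)) (at z)"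
  unfolding K_def using F0_nonzero[of z] assms
  by (auto intro!: derivative_eq_intros F0_has_field_derivative simp: power2_eq_square)

lemma J_eq:
  assumes "t > 0" "norm w \<le> 1"
  shows "J t w = 1 - w * (K t (Z t w) * (of_real t * deriv F0 (Z t w) / (F0 (Z t w))\<^sup>2))"
proof -
  have "w * (K t (Z t w) * x) = Z t w * x" for x
    using Z_fix[of t w] assms by (simp flip: mult.assoc)
  then show ?thesis
    by (simp only: J_def)
qed

text \<open>\<open>J t w\<close> is \<open>1 - w * D\<close>, with \<open>D\<close> the derivative
  of \<open>K t\<close> at the foot. The Lipschitz constant 5/9 bounds \<open>D\<close>, so
  \<open>w * D\<close> cannot equal 1: the contraction that produces the foot also makes it
  differentiable.\<close>

lemma J_nonzero:
  assumes "t > 0" "norm w \<le> 1"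
  shows "J t w \<noteq> 0"
proof
  define D where "D = K t (Z t w) * (of_real t * deriv F0 (Z t w) / (F0 (Z t w))\<^sup>2)"
  assume "J t w = 0"
  then have wD: "w * D = 1"
    by (simp add: J_eq[OF assms] D_def)
  have "norm D \<le> 5 / 9"
  proof (rule norm_deriv_le_of_lipschitz)
    have Z: "norm (Z t w) \<le> radius t"
      using assms by (intro norm_Z_le) auto
    then show "Z t w \<in> cball 0 (radius t)"
      by simp
    show "(K t has_field_derivative D) (at (Z t w) within cball 0 (radius t))"
      unfolding D_def using norm_Z_less_1[OF assms]
      by (intro has_field_derivative_at_within[OF K_has_field_derivative])
    have "Z t w islimpt cball 0 (radius t)"
      using Z radius_pos[of t] by (intro islimpt_subset[OF _ ball_subset_cball]) (simp add: islimpt_ball)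
    then show "at (Z t w) within cball 0 (radius t) \<noteq> bot"
      by (simp add: trivial_limit_within)
    show "norm (K t z - K t (Z t w)) \<le> 5 / 9 * norm (z - Z t w)"
      if "z \<in> cball 0 (radius t)" for z
      using that Z assms by (intro norm_K_diff_space_le) auto
  qed
  then have "norm w * norm D \<le> 1 * (5 / 9)"
    using assms by (intro mult_mono) auto
  then show False
    using arg_cong[OF wD, of norm] by (simp add: norm_mult)
qed

lemma Z_has_space_derivative:
  assumes "t > 0" "norm w \<le> 1"
  shows "(Z t has_field_derivative K t (Z t w) / J t w) (at w within cball 0 1)"
  unfolding has_field_derivative_iff J_eq[OF assms]
proof (rule tendsto_implicit_quotient[OF K_has_field_derivative[OF norm_Z_less_1[OF assms]]])
  have "continuous_on (cball 0 1) (\<lambda>w. (\<lambda>(t, w). Z t w) (t, w))"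
    by (rule continuous_on_compose2[OF continuous_on_Z]) (use assms in \<open>auto intro!: continuous_intros\<close>)
  then show lim: "(Z t \<longlongrightarrow> Z t w) (at w within cball 0 1)"
    using assms(2) by (simp add: continuous_on_def)
  show "\<forall>\<^sub>F v in at w within cball 0 1.
      Z t v - Z t w = (v - w) * K t (Z t v) + w * (K t (Z t v) - K t (Z t w))"
    unfolding eventually_at_filter
  proof (intro always_eventually allI impI)
    fix v :: complex assume "v \<in> cball 0 1"
    then show "Z t v - Z t w = (v - w) * K t (Z t v) + w * (K t (Z t v) - K t (Z t w))"
      using Z_fix[of t v] Z_fix[of t w] assms by (simp add: algebra_simps)
  qed
  show "1 - w * (K t (Z t w) * (of_real t * deriv F0 (Z t w) / (F0 (Z t w))\<^sup>2)) \<noteq> 0"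
    using J_nonzero[OF assms] by (simp add: J_eq[OF assms])
  have "((\<lambda>v. K t (Z t v)) \<longlongrightarrow> K t (Z t w)) (at w within cball 0 1)"
    by (rule isCont_tendsto_compose[OF DERIV_isCont[OF K_has_field_derivative[OF norm_Z_less_1[OF assms]]] lim])
  then show "((\<lambda>v. (v - w) * K t (Z t v) / (v - w)) \<longlongrightarrow> K t (Z t w)) (at w within cball 0 1)"
    by (rule Lim_transform_eventually) (auto simp: eventually_at_filter)
qed

lemma Z_has_time_derivative:
  assumes "t > 0" "norm w \<le> 1"
  shows "((\<lambda>t. Z t w) has_vector_derivative - (Z t w / F0 (Z t w)) / J t w) (at t)"
proof (rule has_vector_derivative_complex_quotient)
  have "((\<lambda>s. (Z s w - Z t w) / of_real (s - t)) \<longlongrightarrow> - (Z t w / F0 (Z t w)) / J t w) (at t within {0<..})"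
    unfolding J_eq[OF assms]
  proof (rule tendsto_implicit_quotient[OF K_has_field_derivative[OF norm_Z_less_1[OF assms]]])
    have "continuous_on {0<..} (\<lambda>t. (\<lambda>(t, w). Z t w) (t, w))"
      by (rule continuous_on_compose2[OF continuous_on_Z]) (use assms in \<open>auto intro!: continuous_intros\<close>)
    then show lim: "((\<lambda>s. Z s w) \<longlongrightarrow> Z t w) (at t within {0<..})"
      using assms(1) by (simp add: continuous_on_def)
    show "\<forall>\<^sub>F s in at t within {0<..}.
        Z s w - Z t w = w * (K s (Z s w) - K t (Z s w)) + w * (K t (Z s w) - K t (Z t w))"
      unfolding eventually_at_filter
    proof (intro always_eventually allI impI)
      fix s :: real assume "s \<in> {0<..}"
      then show "Z s w - Z t w = w * (K s (Z s w) - K t (Z s w)) + w * (K t (Z s w) - K t (Z t w))"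
        using Z_fix[of s w] Z_fix[of t w] assms by (simp add: algebra_simps)
    qed
    show "1 - w * (K t (Z t w) * (of_real t * deriv F0 (Z t w) / (F0 (Z t w))\<^sup>2)) \<noteq> 0"
      using J_nonzero[OF assms] by (simp add: J_eq[OF assms])
    have F0: "((\<lambda>s. F0 (Z s w)) \<longlongrightarrow> F0 (Z t w)) (at t within {0<..})"
      by (rule isCont_tendsto_compose[OF isCont_F0[OF norm_Z_less_1[OF assms]] lim])
    have "F0 (Z t w) \<noteq> 0"
      using norm_Z_less_1[OF assms] by (intro F0_nonzero) auto
    then have p: "((\<lambda>s. - 1 / F0 (Z s w)) \<longlongrightarrow> - 1 / F0 (Z t w)) (at t within {0<..})"
      by (intro tendsto_intros F0)
    have h: "((\<lambda>s. complex_of_real (s - t)) \<longlongrightarrow> 0) (at t within {0<..})"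
      by (auto intro!: tendsto_eq_intros)
    have K: "((\<lambda>s. K t (Z s w)) \<longlongrightarrow> K t (Z t w)) (at t within {0<..})"
      by (rule isCont_tendsto_compose[OF DERIV_isCont[OF K_has_field_derivative[OF norm_Z_less_1[OF assms]]] lim])
    have "((\<lambda>s. w * K t (Z s w) * ((exp (of_real (s - t) * (- 1 / F0 (Z s w))) - 1) / of_real (s - t)))
        \<longlongrightarrow> w * K t (Z t w) * (- 1 / F0 (Z t w))) (at t within {0<..})"
      by (intro tendsto_mult tendsto_const K tendsto_exp_quotient[OF h p])
        (auto simp: eventually_at_filter)
    moreover have "w * K t z * ((exp (of_real (s - t) * (- 1 / F0 z)) - 1) / of_real (s - t)) =
        w * (K s z - K t z) / of_real (s - t)" for s z
    proof -
      have "K t z * exp (of_real (s - t) * (- 1 / F0 z)) = K s z"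
        by (simp add: K_def diff_divide_distrib left_diff_distrib flip: exp_add)
      then have "w * K t z * (exp (of_real (s - t) * (- 1 / F0 z)) - 1) = w * (K s z - K t z)"
        by (simp only: right_diff_distrib mult.assoc mult_1_right)
      then show ?thesis
        by (simp only: times_divide_eq_right)
    qed
    ultimately show "((\<lambda>s. w * (K s (Z s w) - K t (Z s w)) / of_real (s - t))
        \<longlongrightarrow> - (Z t w / F0 (Z t w))) (at t within {0<..})"
      using Z_fix[of t w] assms by (simp only: less_imp_le) simp
  qed
  then show "((\<lambda>s. (Z s w - Z t w) / of_real (s - t)) \<longlongrightarrow> - (Z t w / F0 (Z t w)) / J t w) (at t)"
    using assms(1) by (subst (asm) at_within_open) auto
qed

definition F' :: "real \<Rightarrow> complex \<Rightarrow> complex" where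
  "F' t w = deriv F0 (Z t w) * K t (Z t w) / J t w"

lemma F_has_space_derivative:
  assumes "t > 0" "norm w \<le> 1"
  shows "(F t has_field_derivative F' t w) (at w within cball 0 1)"
proof -
  have "(F0 \<circ> Z t has_field_derivative deriv F0 (Z t w) * (K t (Z t w) / J t w)) (at w within cball 0 1)"
    by (rule DERIV_chain[OF F0_has_field_derivative[OF norm_Z_less_1[OF assms]] Z_has_space_derivative[OF assms]])
  then show ?thesis
    by (simp add: F_def[abs_def] F'_def o_def)
qed

text \<open>The transport equation in the disc: the space and time derivatives of the foot share the
  denominator \<open>J t w\<close>, and \<open>Z_fix\<close> identifies the numerator
  \<open>Z t w\<close> with \<open>w * K t (Z t w)\<close>.\<close>

lemma F_has_time_derivative:
  assumes "t > 0" "norm w \<le> 1"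
  shows "((\<lambda>t. F t w) has_vector_derivative - (w * F' t w / F t w)) (at t)"
proof -
  have "(F0 \<circ> (\<lambda>t. Z t w) has_vector_derivative
      - (Z t w / F0 (Z t w)) / J t w * deriv F0 (Z t w)) (at t)"
    by (rule field_vector_diff_chain_at[OF Z_has_time_derivative[OF assms] F0_has_field_derivative[OF norm_Z_less_1[OF assms]]])
  moreover have "- (Z t w / F0 (Z t w)) / J t w * deriv F0 (Z t w) = - (w * F' t w / F t w)"
  proof -
    have "w * (deriv F0 (Z t w) * K t (Z t w) / J t w) = (w * K t (Z t w)) * deriv F0 (Z t w) / J t w"
      by simp
    also have "\<dots> = Z t w * deriv F0 (Z t w) / J t w"
      using Z_fix[of t w] assms by simp
    finally show ?thesis
      unfolding F'_def F_def by (simp only:) simp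
  qed
  ultimately show ?thesis
    by (simp add: F_def o_def)
qed

lemma F_holomorphic:
  assumes "t > 0"
  shows "F t holomorphic_on ball 0 1"
proof -
  have "(F t has_field_derivative F' t w) (at w)" if "norm w < 1" for w
  proof -
    have "w \<in> interior (cball 0 1)"
      using that by simp
    then show ?thesis
      using F_has_space_derivative[OF assms less_imp_le[OF that]] by (simp only: at_within_interior[of w "cball 0 1"])
  qed
  then show ?thesis
    unfolding holomorphic_on_open[OF open_ball] by (metis mem_ball_0)
qed

lemma continuous_on_F: "continuous_on ({0..} \<times> cball 0 1) (\<lambda>(t, w). F t w)"
proof -
  have "continuous_on ({0..} \<times> cball 0 1) (\<lambda>p. F0 ((\<lambda>(t, w). Z t w) p))"
    by (rule continuous_on_compose2[OF continuous_on_F0 continuous_on_Z]) (auto intro: norm_Z_le_1)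
  then show ?thesis
    by (simp add: F_def split_beta)
qed

text \<open>Time 0 is excluded because \<open>deriv F0\<close> is controlled only in the open disc,
  and the feet of points on the circle enter it only for t > 0.\<close>

lemma continuous_on_F': "continuous_on ({0<..} \<times> cball 0 1) (\<lambda>(t, w). F' t w)"
proof -
  let ?S = "{0<..} \<times> cball (0::complex) 1"
  have Z: "continuous_on ?S (\<lambda>p. Z (fst p) (snd p))"
    using continuous_on_subset[OF continuous_on_Z, of ?S] by (force simp: split_beta)
  have F0: "continuous_on ?S (\<lambda>p. F0 (Z (fst p) (snd p)))"
    by (rule continuous_on_compose2[OF continuous_on_F0 Z]) (auto intro: norm_Z_le_1[OF less_imp_le])
  have dF0: "continuous_on ?S (\<lambda>p. deriv F0 (Z (fst p) (snd p)))"
    using holomorphic_on_imp_continuous_on[OF holomorphic_deriv[OF holomorphic_on_F0]]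
    by (rule continuous_on_compose2[OF _ Z]) (auto simp: norm_Z_less_1)
  have J: "continuous_on ?S (\<lambda>p. J (fst p) (snd p))"
    unfolding J_def by (intro continuous_intros Z F0 dF0) (auto simp: F0_nonzero norm_Z_le_1)
  have K: "continuous_on ?S (\<lambda>p. K (fst p) (Z (fst p) (snd p)))"
    unfolding K_def by (intro continuous_intros F0) (auto simp: F0_nonzero norm_Z_le_1)
  show ?thesis
    unfolding split_beta F'_def
    by (intro continuous_intros J K dF0) (auto simp: J_nonzero)
qed

lemma norm_F_minus_mean_le:
  assumes "t \<ge> 0" "norm w \<le> 1"
  shows "norm (F t w - of_real m) \<le> \<beta> * radius t"
  unfolding F_def using norm_F0_minus_mean_le[OF norm_Z_le[OF assms] radius_le_1[OF assms(1)]] .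

lemma F_zero: "t \<ge> 0 \<Longrightarrow> F t 0 = of_real m"
  by (simp add: F_def Z_zero F0_0)

lemma Re_F_pos: "t \<ge> 0 \<Longrightarrow> norm w \<le> 1 \<Longrightarrow> 0 < Re (F t w)"
  using Re_F0_ge[OF norm_Z_le_1] m_pos unfolding F_def by fastforce

lemma norm_F_le: "t \<ge> 0 \<Longrightarrow> norm w \<le> 1 \<Longrightarrow> norm (F t w) \<le> 2 * m"
  unfolding F_def by (intro norm_F0_le norm_Z_le_1)

text \<open>A Lipschitz constant of \<open>F t\<close> on the closed disc: 9/4 and one power of
  \<open>radius t\<close> come from \<open>Z_lipschitz_space\<close>, the rest from
  \<open>norm_F0_diff_le\<close>. At t = 0 the series may diverge, and \<open>suminf\<close> then
  carries no information.\<close>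

definition speed :: "real \<Rightarrow> real" where
  "speed t = 9 / 4 * (\<Sum>n. norm (b n) * real (Suc n) * radius t ^ Suc n)"

lemma norm_F_diff_le:
  assumes "t > 0" "norm w \<le> 1" "norm w' \<le> 1"
  shows "norm (F t w - F t w') \<le> speed t * norm (w - w')"
proof -
  let ?\<sigma> = "\<Sum>n. norm (b n) * (real (Suc n) * radius t ^ n)"
  have r: "0 \<le> radius t" "radius t < 1"
    using radius_pos[of t] radius_less_1[OF assms(1)] by auto
  have "0 \<le> ?\<sigma>"
    by (rule suminf_nonneg[OF summable_speed[OF r]]) (use r in auto)
  have "norm (F t w - F t w') \<le> ?\<sigma> * norm (Z t w - Z t w')"
    unfolding F_def using assms r by (intro norm_F0_diff_le norm_Z_le) auto
  also have "\<dots> \<le> ?\<sigma> * (9 / 4 * radius t * norm (w - w'))"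
    using assms \<open>0 \<le> ?\<sigma>\<close> by (intro mult_left_mono Z_lipschitz_space) auto
  also have "\<dots> = 9 / 4 * (?\<sigma> * radius t) * norm (w - w')"
    by simp
  also have "?\<sigma> * radius t = (\<Sum>n. norm (b n) * (real (Suc n) * radius t ^ n) * radius t)"
    by (rule suminf_mult2[OF summable_speed[OF r]])
  finally show ?thesis
    by (simp add: speed_def mult_ac)
qed

lemma norm_F'_le:
  assumes "t > 0" "norm w \<le> 1"
  shows "norm (F' t w) \<le> speed t"
proof (rule norm_deriv_le_of_lipschitz[OF F_has_space_derivative[OF assms]])
  show "at w within cball 0 1 \<noteq> bot"
    using assms(2) islimpt_subset[OF _ ball_subset_cball, of w 0 1]
    by (simp add: trivial_limit_within islimpt_ball)
qed (use assms norm_F_diff_le in auto)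

text \<open>Up to a constant, \<open>speed\<close> is the time derivative of
  \<open>G (radius t)\<close>, and \<open>G\<close> is continuous up to radius 1 because the norms
  of the coefficients are summable. Asking for derivatives only in the interior allows
  \<open>speed\<close> to blow up at t = 0.\<close>

lemma speed_integrable:
  assumes "T > 0"
  shows "speed integrable_on {0..T}"
proof -
  define G where "G r = (\<Sum>n. norm (b n) * r ^ Suc n)" for r :: real
  have le: "norm (norm (b n) * r ^ Suc n) \<le> norm (b n)" if "\<bar>r\<bar> \<le> 1" for n r
    using power_le_one[OF _ that, of "Suc n"]
    by (simp add: abs_mult power_abs mult_left_le del: power_Suc)
  have "uniform_limit (cball 0 1) (\<lambda>n r. \<Sum>i<n. norm (b i) * r ^ Suc i) G sequentially"
    unfolding G_def by (rule Weierstrass_m_test[OF _ summable_b]) (use le in auto)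
  then have contG: "continuous_on (cball 0 1) G"
    by (rule uniform_limit_theorem[OF always_eventually[OF allI] _ trivial_limit_sequentially, rotated])
       (intro continuous_intros)
  have "continuous_on {0..T} (\<lambda>t. G (radius t))"
  proof (rule continuous_on_compose2[OF contG])
    show "continuous_on {0..T} radius"
      unfolding radius_def by (intro continuous_intros)
    show "radius ` {0..T} \<subseteq> cball 0 1"
      using radius_pos radius_le_1 by (auto simp: less_imp_le)
  qed
  then have cont: "continuous_on {0..T} (\<lambda>t. - (9 / 4 / \<delta>) * G (radius t))"
    by (rule continuous_on_mult_left)
  have "(speed has_integral - (9 / 4 / \<delta>) * G (radius T) - - (9 / 4 / \<delta>) * G (radius 0)) {0..T}"
  proof (rule fundamental_theorem_of_calculus_interior[OF _ cont])
    fix t assume t: "t \<in> {0<..<T}"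
    then have r: "0 \<le> radius t" "radius t < 1"
      using radius_pos[of t] radius_less_1[of t] by auto
    have "summable (\<lambda>n. norm (b n) * real (Suc n) * x ^ n)" if "x \<in> {-1<..<1}" for x
      by (rule summable_comparison_test'[OF summable_speed[of "\<bar>x\<bar>"]])
        (use that in \<open>auto simp: abs_mult power_abs\<close>)
    then have "DERIV G (radius t) :> (\<Sum>n. norm (b n) * real (Suc n) * radius t ^ n)"
      unfolding G_def by (rule DERIV_power_series'[of 1]) (use r in auto)
    moreover have "DERIV radius t :> - \<delta> * radius t"
      unfolding radius_def by (auto intro!: derivative_eq_intros)
    ultimately have "DERIV (\<lambda>t. G (radius t)) t :>
        (\<Sum>n. norm (b n) * real (Suc n) * radius t ^ n) * (- \<delta> * radius t)"
      by (rule DERIV_chain2)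
    from DERIV_cmult[OF this, of "- (9 / 4 / \<delta>)"]
    have "DERIV (\<lambda>t. - (9 / 4 / \<delta>) * G (radius t)) t :>
        9 / 4 * ((\<Sum>n. norm (b n) * real (Suc n) * radius t ^ n) * radius t)"
      using \<delta>_pos by simp
    also have "(\<Sum>n. norm (b n) * real (Suc n) * radius t ^ n) * radius t =
        (\<Sum>n. norm (b n) * real (Suc n) * radius t ^ n * radius t)"
      using summable_speed[OF r] by (intro suminf_mult2) (simp add: mult.assoc)
    finally show "((\<lambda>t. - (9 / 4 / \<delta>) * G (radius t)) has_vector_derivative speed t) (at t)"
      by (simp add: speed_def has_real_derivative_iff_has_vector_derivative[symmetric] mult_ac)
  qed (use assms in auto)
  then show ?thesis
    by blast
qed

end

section \<open>Hilbert transform of boundary values\<close>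

text \<open>Cauchy's integral formula at the centre, for functions merely continuous on the
  boundary. The rotation by \<open>cis a\<close> moves the start of the period, so that it can be
  centred at the singularity of the kernel.\<close>

lemma mean_value_circle:
  fixes h :: "complex \<Rightarrow> complex"
  assumes "continuous_on (cball 0 1) h" "h holomorphic_on ball 0 1"
  shows "((\<lambda>y. h (cis y)) has_integral 2 * pi * h 0) {a..a + 2 * pi}"
proof -
  define g where "g z = h (cis a * z)" for z
  have "continuous_on (cball 0 1) g"
    unfolding g_def by (rule continuous_on_compose2[OF assms(1)]) (auto intro!: continuous_intros simp: norm_mult)
  moreover have "g holomorphic_on ball 0 1"
    unfolding g_def
    by (rule holomorphic_on_compose_gen[OF _ assms(2), unfolded o_def])
       (auto intro!: holomorphic_intros simp: norm_mult)
  ultimately have "((\<lambda>u. g u / (u - 0)) has_contour_integral 2 * of_real pi * \<i> * g 0) (circlepath 0 1)"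
    by (rule Cauchy_integral_circlepath) simp
  then have "((\<lambda>y. g (cis y) * \<i>) has_integral 2 * of_real pi * \<i> * g 0) {0..2 * pi}"
    unfolding circlepath_def by (subst (asm) has_contour_integral_part_circlepath_iff) auto
  from has_integral_mult_right[OF this, of "- \<i>"]
  have "((\<lambda>y. h (cis (a + y))) has_integral 2 * pi * h 0) {0..2 * pi}"
    by (simp add: g_def cis_mult algebra_simps)
  from has_integral_affinity'[OF this[folded cbox_interval], of 1 "- a"] show ?thesis
    by (simp add: algebra_simps cbox_interval)
qed

lemma cis_kernel:
  assumes "sin ((x - y) / 2) \<noteq> 0"
  shows "- \<i> * (cis x + cis y) / (cis y - cis x) = of_real (1 / tan ((x - y) / 2))"
proof -
  define a b where "a = (x - y) / 2" and "b = (x + y) / 2"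
  have xy: "x = b + a" "y = b - a"
    by (simp_all add: a_def b_def field_simps)
  have add: "cis x + cis y = 2 * of_real (cos a) * cis b"
    by (simp add: xy complex_eq_iff cos_add cos_diff sin_add sin_diff)
  have diff: "cis y - cis x = - 2 * \<i> * of_real (sin a) * cis b"
    by (simp add: xy complex_eq_iff cos_add cos_diff sin_add sin_diff)
  have "sin a \<noteq> 0"
    using assms by (simp add: a_def)
  then have "- \<i> * (cis x + cis y) / (cis y - cis x) = of_real (cos a / sin a)"
    unfolding add diff by (simp add: field_simps)
  then show ?thesis
    by (simp add: a_def tan_def)
qed

text \<open>The antiderivative \<open>- 2 * ln (sin ((x - y) / 2))\<close> vanishes at the far end
  since \<open>sin (pi / 2) = 1\<close>. The value is opposite to the one on the right of x, so the
  truncated kernel has total integral 0.\<close>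

lemma has_integral_cot_left:
  assumes "0 < e" "e < pi"
  shows "((\<lambda>y. 1 / tan ((x - y) / 2)) has_integral - 2 * ln (sin (e / 2))) {x - pi..x - e}"
proof -
  have "((\<lambda>y. 1 / tan ((x - y) / 2)) has_integral
      - 2 * ln (sin ((x - (x - e)) / 2)) - - 2 * ln (sin ((x - (x - pi)) / 2))) {x - pi..x - e}"
  proof (rule fundamental_theorem_of_calculus)
    fix y assume "y \<in> {x - pi..x - e}"
    then have pos: "sin ((x - y) / 2) > 0"
      using assms by (intro sin_gt_zero) auto
    have "((\<lambda>y. - 2 * ln (sin ((x - y) / 2))) has_real_derivative
        - 2 * (1 / sin ((x - y) / 2) * (cos ((x - y) / 2) * (- 1 / 2)))) (at y within {x - pi..x - e})"
      using pos by (auto intro!: derivative_eq_intros)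
    then show "((\<lambda>y. - 2 * ln (sin ((x - y) / 2))) has_vector_derivative 1 / tan ((x - y) / 2))
        (at y within {x - pi..x - e})"
      by (simp add: has_real_derivative_iff_has_vector_derivative tan_def)
  qed (use assms in auto)
  then show ?thesis
    by simp
qed

lemma has_integral_cot_right:
  assumes "0 < e" "e < pi"
  shows "((\<lambda>y. 1 / tan ((x - y) / 2)) has_integral 2 * ln (sin (e / 2))) {x + e..x + pi}"
proof -
  have "((\<lambda>y. 1 / tan ((x - y) / 2)) has_integral
      - 2 * ln (sin ((x + pi - x) / 2)) - - 2 * ln (sin ((x + e - x) / 2))) {x + e..x + pi}"
  proof (rule fundamental_theorem_of_calculus)
    fix y assume "y \<in> {x + e..x + pi}"
    then have pos: "sin ((y - x) / 2) > 0"
      using assms by (intro sin_gt_zero) auto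
    have "(x - y) / 2 = - ((y - x) / 2)"
      by (simp add: field_simps)
    then have tan: "1 / tan ((x - y) / 2) = - (cos ((y - x) / 2) / sin ((y - x) / 2))"
      by (simp only: tan_def sin_minus cos_minus) simp
    have "((\<lambda>y. - 2 * ln (sin ((y - x) / 2))) has_real_derivative
        - 2 * (1 / sin ((y - x) / 2) * (cos ((y - x) / 2) * (1 / 2)))) (at y within {x + e..x + pi})"
      using pos by (auto intro!: derivative_eq_intros)
    then show "((\<lambda>y. - 2 * ln (sin ((y - x) / 2))) has_vector_derivative 1 / tan ((x - y) / 2))
        (at y within {x + e..x + pi})"
      unfolding tan by (simp add: has_real_derivative_iff_has_vector_derivative)
  qed (use assms in auto)
  then show ?thesis
    by simp
qed

text \<open>Since the truncated kernel has integral 0, subtracting the value at x changes nothing,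
  and \<open>k\<close> extends the resulting integrand continuously across y = x.\<close>

lemma hilbert_truncated_eq_integral:
  fixes k :: "real \<Rightarrow> real"
  assumes cont: "continuous_on UNIV k"
    and k: "\<And>y. sin ((x - y) / 2) \<noteq> 0 \<Longrightarrow> k y = (u y - u x) * (1 / tan ((x - y) / 2))"
    and e: "0 < e" "e < pi"
  shows "hilbert_truncated u x e =
    1 / (2 * pi) * (integral {x - pi..x - e} k + integral {x + e..x + pi} k)"
proof -
  define f where "f y = u y / tan ((x - y) / 2)" for y
  let ?A = "{x - pi..x - e}" and ?B = "{x + e..x + pi}"
  have AB: "{y. e \<le> \<bar>x - y\<bar> \<and> \<bar>x - y\<bar> \<le> pi} = ?A \<union> ?B"
    using e by auto
  have sin: "sin ((x - y) / 2) \<noteq> 0" if "y \<in> ?A \<union> ?B" for y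
  proof (cases "y \<in> ?A")
    case True
    then have "0 < sin ((x - y) / 2)"
      using e by (intro sin_gt_zero) auto
    then show ?thesis by simp
  next
    case False
    then have "0 < sin ((y - x) / 2)"
      using that e by (intro sin_gt_zero) auto
    moreover have "(x - y) / 2 = - ((y - x) / 2)"
      by (simp add: field_simps)
    ultimately show ?thesis
      by (simp only: sin_minus)
  qed
  have f: "f y = k y + u x * (1 / tan ((x - y) / 2))" if "y \<in> ?A \<union> ?B" for y
    using k[OF sin[OF that]] by (simp add: f_def diff_divide_distrib)
  have contf: "continuous_on (?A \<union> ?B) f"
  proof (rule continuous_on_eq)
    show "continuous_on (?A \<union> ?B) (\<lambda>y. k y + u x * (cos ((x - y) / 2) / sin ((x - y) / 2)))"
      using sin by (intro continuous_intros continuous_on_subset[OF cont]) auto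
  qed (simp add: f tan_def)
  have int: "f absolutely_integrable_on ?A" "f absolutely_integrable_on ?B"
    using contf by (auto intro!: absolutely_integrable_continuous_real elim: continuous_on_subset)
  have k': "k integrable_on {a..b}" for a b
    using cont by (intro integrable_continuous_real) (rule continuous_on_subset, auto)
  have A: "integral ?A f = integral ?A k + u x * (- 2 * ln (sin (e / 2)))"
    using has_integral_add[OF integrable_integral[OF k'] has_integral_mult_right[OF has_integral_cot_left[OF e]]]
    by (intro integral_unique) (rule has_integral_eq[rotated], assumption, simp add: f)
  have B: "integral ?B f = integral ?B k + u x * (2 * ln (sin (e / 2)))"
    using has_integral_add[OF integrable_integral[OF k'] has_integral_mult_right[OF has_integral_cot_right[OF e]]]
    by (intro integral_unique) (rule has_integral_eq[rotated], assumption, simp add: f)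
  have "(LINT y:?A \<union> ?B|lebesgue. f y) = (LINT y:?A|lebesgue. f y) + (LINT y:?B|lebesgue. f y)"
    using e int by (intro set_integral_Un) auto
  also have "\<dots> = integral ?A k + integral ?B k"
    by (simp add: set_lebesgue_integral_eq_integral(2)[OF int(1)]
        set_lebesgue_integral_eq_integral(2)[OF int(2)] A B)
  finally show ?thesis
    unfolding hilbert_truncated_def AB f_def by (rule arg_cong)
qed

lemma tendsto_punctured_integral:
  fixes k :: "real \<Rightarrow> real"
  assumes cont: "continuous_on UNIV k" and p: "p > 0"
  shows "((\<lambda>e. integral {x - p..x - e} k + integral {x + e..x + p} k) \<longlongrightarrow> integral {x - p..x + p} k)
    (at_right 0)"
proof -
  define I where "I s = integral {x - p..s} k" for s
  have int: "k integrable_on {a..b}" for a b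
    using cont by (intro integrable_continuous_real) (rule continuous_on_subset, auto)
  have contI: "continuous_on {x - p..x + p} I"
    unfolding I_def by (rule indefinite_integral_continuous_1[OF int])
  then have "isCont I x"
    using p continuous_on_interior by fastforce
  then have lim: "(I \<longlongrightarrow> I x) (nhds x)"
    by (simp add: isCont_def tendsto_nhds_iff)
  have sub: "filterlim (\<lambda>e. x - e) (nhds x) (at_right 0)" "filterlim (\<lambda>e. x + e) (nhds x) (at_right 0)"
    by (auto intro!: tendsto_eq_intros)
  have "((\<lambda>e. I (x - e) + (I (x + p) - I (x + e))) \<longlongrightarrow> I x + (I (x + p) - I x)) (at_right 0)"
    by (intro tendsto_intros filterlim_compose[OF lim] sub)
  moreover have "\<forall>\<^sub>F e in at_right 0. I (x - e) + (I (x + p) - I (x + e)) =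
      integral {x - p..x - e} k + integral {x + e..x + p} k"
    using eventually_at_right_less[of 0] eventually_at_right_real[OF p]
  proof eventually_elim
    case (elim e)
    then have "integral {x - p..x + e} k + integral {x + e..x + p} k = integral {x - p..x + p} k"
      by (intro Henstock_Kurzweil_Integration.integral_combine int) auto
    then show ?case
      by (simp add: I_def)
  qed
  ultimately show ?thesis
    using Lim_transform_eventually by (force simp: I_def)
qed

text \<open>The kernel \<open>1 / tan ((x - y) / 2)\<close> is the boundary value of \<open>- \<i> * (w + z) / (z - w)\<close> at
  \<open>w = cis x\<close>, \<open>z = cis y\<close>, so the mean value property at \<open>z = 0\<close> evaluates the integral.\<close>

lemma hilbert_truncated_boundary:
  assumes cont: "continuous_on (cball 0 1) G" and hol: "G holomorphic_on ball 0 1"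
    and deriv: "(G has_field_derivative D) (at (cis x) within cball 0 1)" and "Im (G 0) = 0"
  shows "(hilbert_truncated (\<lambda>y. Re (G (cis y))) x \<longlongrightarrow> Im (G (cis x))) (at_right 0)"
proof -
  let ?w = "cis x"
  \<comment> \<open>Completing the difference quotient by \<open>D\<close> at the boundary point
    absorbs the pole of the kernel and keeps \<open>h\<close> continuous on the closed disc.\<close>
  define q where "q z = (if z = ?w then D else (G z - G ?w) / (z - ?w))" for z
  define h where "h z = - \<i> * (?w + z) * q z" for z
  define k where "k y = Re (h (cis y))" for y
  have "continuous_on (cball 0 1) q"
    unfolding continuous_on_eq_continuous_within
  proof
    fix z :: complex assume z: "z \<in> cball 0 1"
    show "continuous (at z within cball 0 1) q"
    proof (cases "z = ?w")
      case True
      have "((\<lambda>z. (G z - G ?w) / (z - ?w)) \<longlongrightarrow> q ?w) (at ?w within cball 0 1)"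
        using deriv by (simp add: q_def has_field_derivative_iff)
      then have "(q \<longlongrightarrow> q ?w) (at ?w within cball 0 1)"
        by (rule Lim_transform_eventually) (auto simp: q_def eventually_at_filter)
      then show ?thesis
        by (simp add: True continuous_within)
    next
      case False
      have "((\<lambda>z. (G z - G ?w) / (z - ?w)) \<longlongrightarrow> q z) (at z within cball 0 1)"
        using cont z False by (auto simp: q_def continuous_on_def intro!: tendsto_intros)
      moreover have "\<forall>\<^sub>F y in at z within cball 0 1. y \<noteq> ?w"
        using False by (rule tendsto_imp_eventually_ne[OF tendsto_ident_at])
      then have "\<forall>\<^sub>F y in at z within cball 0 1. (G y - G ?w) / (y - ?w) = q y"
        by eventually_elim (simp add: q_def)
      ultimately show ?thesis
        unfolding continuous_within by (rule Lim_transform_eventually)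
    qed
  qed
  then have conth: "continuous_on (cball 0 1) h"
    unfolding h_def by (intro continuous_intros)
  have "h holomorphic_on ball 0 1"
  proof (rule holomorphic_transform)
    show "(\<lambda>z. - \<i> * (?w + z) * ((G z - G ?w) / (z - ?w))) holomorphic_on ball 0 1"
      using hol by (intro holomorphic_intros) auto
  qed (auto simp: h_def q_def)
  from mean_value_circle[OF conth this, of "x - pi"]
  have int: "((\<lambda>y. h (cis y)) has_integral 2 * pi * h 0) {x - pi..x + pi}"
    by (simp add: algebra_simps)
  \<comment> \<open>The real part of this value is \<open>Im (G ?w) - Im (G 0)\<close>; the
    normalisation of \<open>G 0\<close> leaves the boundary value of the conjugate function.\<close>
  have "h 0 = \<i> * (G 0 - G ?w)"
    by (auto simp: h_def q_def field_simps)
  with has_integral_linear[OF int bounded_linear_Re] assms(4)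
  have int_k: "integral {x - pi..x + pi} k = 2 * pi * Im (G ?w)"
    by (intro integral_unique) (simp add: k_def[abs_def] o_def)
  have contk: "continuous_on UNIV k"
    unfolding k_def by (intro continuous_intros continuous_on_compose2[OF conth]) auto
  have k: "k y = (Re (G (cis y)) - Re (G ?w)) * (1 / tan ((x - y) / 2))"
    if "sin ((x - y) / 2) \<noteq> 0" for y
  proof -
    have "cis y \<noteq> ?w"
    proof
      assume "cis y = ?w"
      then have "cis (x - y) = 1"
        by (simp flip: cis_divide)
      then have "cos (x - y) = 1"
        by (simp add: complex_eq_iff)
      then show False
        using that cos_double_sin[of "(x - y) / 2", unfolded nonzero_mult_div_cancel_left] by (simp add: diff_divide_distrib)
    qed
    then have "h (cis y) = (- \<i> * (?w + cis y) / (cis y - ?w)) * (G (cis y) - G ?w)"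
      by (simp add: h_def q_def)
    then show ?thesis
      unfolding cis_kernel[OF that] k_def by simp
  qed
  have "((\<lambda>e. 1 / (2 * pi) * (integral {x - pi..x - e} k + integral {x + e..x + pi} k)) \<longlongrightarrow>
      1 / (2 * pi) * (2 * pi * Im (G ?w))) (at_right 0)"
    unfolding int_k[symmetric] by (intro tendsto_intros tendsto_punctured_integral contk) simp
  moreover have "\<forall>\<^sub>F e in at_right 0. 1 / (2 * pi) * (integral {x - pi..x - e} k + integral {x + e..x + pi} k)
      = hilbert_truncated (\<lambda>y. Re (G (cis y))) x e"
    using eventually_at_right_real[OF pi_gt_zero]
    by eventually_elim (simp add: hilbert_truncated_eq_integral[OF contk k])
  ultimately show ?thesis
    using Lim_transform_eventually by fastforce
qed

section \<open>Fourier coefficients\<close>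

lemma absolutely_integrable_scaleR_continuous:
  fixes f :: "real \<Rightarrow> real" and g :: "real \<Rightarrow> 'b::euclidean_space"
  assumes f: "f absolutely_integrable_on {a..b}" and g: "continuous_on {a..b} g"
  shows "(\<lambda>x. f x *\<^sub>R g x) absolutely_integrable_on {a..b}"
proof -
  obtain B where B: "\<And>x. x \<in> {a..b} \<Longrightarrow> norm (g x) \<le> B"
    using compact_imp_bounded[OF compact_continuous_image[OF g compact_Icc]]
    by (force simp: bounded_iff)
  show ?thesis
  proof (rule measurable_bounded_by_integrable_imp_absolutely_integrable)
    show "(\<lambda>x. f x *\<^sub>R g x) \<in> borel_measurable (lebesgue_on {a..b})"
      using integrable_imp_measurable[OF set_lebesgue_integral_eq_integral(1)[OF f]]
        continuous_imp_measurable_on_sets_lebesgue[OF g]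
      by (intro borel_measurable_scaleR) auto
    show "(\<lambda>x. \<bar>f x\<bar> * B) integrable_on {a..b}"
      using absolutely_integrable_norm[OF f]
      by (intro integrable_on_mult_left) (auto simp: o_def dest: set_lebesgue_integral_eq_integral(1))
    show "norm (f x *\<^sub>R g x) \<le> \<bar>f x\<bar> * B" if "x \<in> {a..b}" for x
      using B[OF that] by (simp add: mult_left_mono)
  qed auto
qed

lemma has_integral_cnj: "(f has_integral I) S \<Longrightarrow> ((\<lambda>x. cnj (f x)) has_integral cnj I) S"
  using has_integral_linear[OF _ bounded_linear_cnj] by (simp add: o_def)

lemma has_integral_cis:
  "((\<lambda>x. cis (of_int n * x)) has_integral (if n = 0 then of_real (2 * pi) else 0)) {0..2 * pi}"
proof -
  have pos: "((\<lambda>x. cis (real k * x)) has_integral 0) {0..2 * pi}" if "k > 0" for k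
  proof -
    have "continuous_on (cball 0 1) (\<lambda>z::complex. z ^ k)" "(\<lambda>z. z ^ k) holomorphic_on ball 0 1"
      by (intro continuous_intros holomorphic_intros)+
    from mean_value_circle[OF this, of 0] show ?thesis
      using that by (simp add: Complex.DeMoivre power_0_left)
  qed
  consider "n = 0" | "n > 0" | "n < 0"
    by linarith
  then show ?thesis
  proof cases
    case 1
    then show ?thesis
      using has_integral_const_real[of "1::complex" 0 "2 * pi"] by (simp add: scaleR_conv_of_real)
  next
    case 2
    then show ?thesis
      using pos[of "nat n"] by simp
  next
    case 3
    then show ?thesis
      using has_integral_cnj[OF pos[of "nat (- n)"]] by (simp add: cis_cnj)
  qed
qed

lemma continuous_on_cis_mult: "continuous_on S (\<lambda>x. cis (c * x))"
  by (intro continuous_intros)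

lemma has_integral_fourier_coeff:
  assumes "f absolutely_integrable_on {0..2 * pi}"
  shows "((\<lambda>x. of_real (f x) * cis (- (of_int n * x))) has_integral
    of_real (2 * pi) * fourier_coeff f n) {0..2 * pi}"
proof -
  have "(\<lambda>x. f x *\<^sub>R cis (- of_int n * x)) absolutely_integrable_on {0..2 * pi}"
    by (rule absolutely_integrable_scaleR_continuous[OF assms continuous_on_cis_mult])
  then have "(\<lambda>x. of_real (f x) * cis (- (of_int n * x))) absolutely_integrable_on {0..2 * pi}"
    by (simp add: scaleR_conv_of_real)
  from has_integral_set_lebesgue[OF this] show ?thesis
    by (simp add: fourier_coeff_def)
qed

lemma fourier_coeffI:
  assumes "f absolutely_integrable_on {0..2 * pi}"
    and "((\<lambda>x. of_real (f x) * cis (- (of_int n * x))) has_integral of_real (2 * pi) * c) {0..2 * pi}"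
  shows "fourier_coeff f n = c"
  using has_integral_unique[OF has_integral_fourier_coeff[OF assms(1)] assms(2)] by simp

lemma fourier_coeff_uminus:
  assumes "f absolutely_integrable_on {0..2 * pi}"
  shows "fourier_coeff f (- n) = cnj (fourier_coeff f n)"
  using has_integral_cnj[OF has_integral_fourier_coeff[OF assms, of n]]
  by (intro fourier_coeffI[OF assms]) (simp add: cis_cnj)

lemma fourier_coeff_0:
  assumes "f absolutely_integrable_on {0..2 * pi}"
  shows "fourier_coeff f 0 = of_real (circle_mean f)"
proof (rule fourier_coeffI[OF assms])
  have "(f has_integral 2 * pi * circle_mean f) {0..2 * pi}"
    using has_integral_set_lebesgue[OF assms] by (simp add: circle_mean_def)
  from has_integral_linear[OF this bounded_linear_of_real]
  show "((\<lambda>x. of_real (f x) * cis (- (of_int 0 * x))) has_integral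
      of_real (2 * pi) * of_real (circle_mean f)) {0..2 * pi}"
    by (simp add: o_def)
qed

lemma fourier_coeff_diff:
  assumes "f absolutely_integrable_on {0..2 * pi}" "g absolutely_integrable_on {0..2 * pi}"
  shows "fourier_coeff (\<lambda>x. f x - g x) n = fourier_coeff f n - fourier_coeff g n"
  using has_integral_diff[OF has_integral_fourier_coeff[OF assms(1), of n] has_integral_fourier_coeff[OF assms(2), of n]]
  by (intro fourier_coeffI set_integral_diff(1) assms) (simp add: algebra_simps)

lemma fourier_coeff_const: "fourier_coeff (\<lambda>x. c) n = (if n = 0 then of_real c else 0)"
proof (rule fourier_coeffI)
  show "((\<lambda>x. of_real c * cis (- (of_int n * x))) has_integral
      of_real (2 * pi) * (if n = 0 then of_real c else 0)) {0..2 * pi}"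
    using has_integral_mult_right[OF has_integral_cis[of "- n"], of "of_real c"] by (simp add: mult.commute split: if_splits)
qed (auto intro: absolutely_integrable_continuous_real)

section \<open>Trigonometric approximation and uniqueness of Fourier coefficients\<close>

inductive trig_poly :: "(real \<Rightarrow> complex) \<Rightarrow> bool" where
  cis: "trig_poly (\<lambda>x. cis (of_int n * x))"
| scale: "trig_poly f \<Longrightarrow> trig_poly (\<lambda>x. c * f x)"
| add: "trig_poly f \<Longrightarrow> trig_poly g \<Longrightarrow> trig_poly (\<lambda>x. f x + g x)"

lemma trig_poly_mult:
  assumes "trig_poly f" "trig_poly g"
  shows "trig_poly (\<lambda>x. f x * g x)"
  using assms
proof (induction f)
  case (cis n)
  from cis show ?case
  proof (induction g)
    case (cis k)
    show ?case
      using trig_poly.cis[of "n + k"] by (simp add: cis_mult algebra_simps)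
  next
    case (scale f c)
    from trig_poly.scale[OF scale.IH, of c] show ?case
      by (simp add: mult_ac)
  next
    case (add f g)
    from trig_poly.add[OF add.IH] show ?case
      by (simp add: algebra_simps)
  qed
next
  case (scale f c)
  from trig_poly.scale[OF scale.IH[OF scale.prems], of c] show ?case
    by (simp add: mult_ac)
next
  case (add f h)
  from trig_poly.add[OF add.IH(1)[OF add.prems] add.IH(2)[OF add.prems]] show ?case
    by (simp add: algebra_simps)
qed

text \<open>On the circle a real-linear functional of \<open>cis x\<close> is a combination of
  \<open>cis x\<close> and its conjugate. This links Stone-Weierstrass in the plane to trigonometric
  polynomials.\<close>

lemma trig_poly_of_real_polynomial_function:
  fixes p :: "complex \<Rightarrow> real"
  assumes "real_polynomial_function p"
  shows "trig_poly (\<lambda>x. of_real (p (cis x)))"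
  using assms
proof (induction p)
  case (linear h)
  interpret h: bounded_linear h by fact
  define a b where "a = complex_of_real (h 1)" and "b = complex_of_real (h \<i>)"
  have "of_real (h (cis x)) = (a - \<i> * b) / 2 * cis (of_int 1 * x) + (a + \<i> * b) / 2 * cis (of_int (- 1) * x)"
    for x
  proof -
    have "cis x = cos x *\<^sub>R 1 + sin x *\<^sub>R \<i>"
      by (simp add: complex_eq_iff)
    then have "h (cis x) = cos x * h 1 + sin x * h \<i>"
      by (simp only: h.add h.scaleR real_scaleR_def)
    then have "complex_of_real (h (cis x)) = of_real (cos x) * a + of_real (sin x) * b"
      by (simp add: a_def b_def)
    then show ?thesis
      by (simp add: cis_conv_exp complex_eq_iff field_simps Euler a_def b_def)
  qed
  then show ?case
    by (simp only:) (intro trig_poly.intros)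
next
  case (const c)
  show ?case
    using trig_poly.scale[OF trig_poly.cis[of 0], of "of_real c"] by simp
next
  case (add f g)
  then show ?case
    by (simp add: trig_poly.add)
next
  case (mult f g)
  then show ?case
    by (simp add: trig_poly_mult)
qed

lemma periodic_eq_on_circle:
  assumes "periodic f" "cis x = cis y"
  shows "f x = f y"
proof -
  have nat: "f (x + 2 * pi * of_nat k) = f x" for k x
  proof (induction k)
    case (Suc k)
    have "f (x + 2 * pi * of_nat (Suc k)) = f ((x + 2 * pi * of_nat k) + 2 * pi)"
      by (simp add: algebra_simps)
    then show ?case
      using assms(1) Suc by (simp add: periodic_def)
  qed simp
  have "cos (x - y) = 1"
    using assms(2) by (simp add: cos_diff complex_eq_iff flip: power2_eq_square)
  then obtain n :: int where n: "x - y = 2 * pi * of_int n"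
    by (auto simp: cos_one_2pi_int mult_ac)
  show ?thesis
  proof (cases "n \<ge> 0")
    case True
    then show ?thesis
      using n nat[of y "nat n"] by (simp add: algebra_simps)
  next
    case False
    then show ?thesis
      using n nat[of x "nat (- n)"] by (simp add: algebra_simps)
  qed
qed

text \<open>The function is carried to the circle by \<open>Arg\<close> and approximated there. As
  \<open>Arg\<close> jumps on the negative axis, continuity is shown through preimages of closed
  sets: they are images under \<open>cis\<close> of compact subsets of \<open>{- pi..pi}\<close>,
  since periodicity reconciles the two end points.\<close>

lemma trig_poly_approx:
  fixes \<phi> :: "real \<Rightarrow> real"
  assumes cont: "continuous_on UNIV \<phi>" and per: "periodic \<phi>" and "e > 0"
  obtains p where "trig_poly (\<lambda>x. of_real (p x))" "\<And>x. \<bar>\<phi> x - p x\<bar> < e" "continuous_on UNIV p"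
proof -
  define \<Psi> where "\<Psi> z = \<phi> (Arg z)" for z
  have \<Psi>: "\<Psi> (cis x) = \<phi> x" for x
    unfolding \<Psi>_def by (intro periodic_eq_on_circle[OF per]) (simp add: cis_Arg sgn_eq)
  have "continuous_on (sphere 0 1) \<Psi>"
    unfolding continuous_on_closed_vimage[OF closed_sphere]
  proof (intro allI impI)
    fix B :: "real set" assume "closed B"
    have "\<Psi> -` B \<inter> sphere 0 1 = cis ` ({- pi..pi} \<inter> \<phi> -` B)"
    proof safe
      fix z assume z: "z \<in> sphere (0::complex) 1" "\<Psi> z \<in> B"
      then have "cis (Arg z) = z"
        using cis_Arg[of z] by (cases "z = 0") (auto simp: sgn_eq)
      moreover have "Arg z \<in> {- pi..pi} \<inter> \<phi> -` B"
        using z Arg_bounded[of z] by (auto simp: \<Psi>_def)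
      ultimately show "z \<in> cis ` ({- pi..pi} \<inter> \<phi> -` B)"
        by (metis imageI)
    qed (auto simp: \<Psi>)
    moreover have "closed (\<phi> -` B)"
      using cont \<open>closed B\<close> by (simp add: closed_vimage continuous_on_eq_continuous_at isCont_def)
    then have "compact ({- pi..pi} \<inter> \<phi> -` B)"
      by (intro compact_Int_closed) auto
    then have "closed (cis ` ({- pi..pi} \<inter> \<phi> -` B))"
      by (intro compact_imp_closed compact_continuous_image continuous_intros)
    ultimately show "closed (\<Psi> -` B \<inter> sphere 0 1)"
      by simp
  qed
  then obtain g where g: "real_polynomial_function g" "\<And>z. z \<in> sphere 0 1 \<Longrightarrow> \<bar>\<Psi> z - g z\<bar> < e"
    using Stone_Weierstrass_real_polynomial_function[OF compact_sphere _ \<open>e > 0\<close>] by blast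
  show ?thesis
  proof
    show "trig_poly (\<lambda>x. of_real (g (cis x)))"
      by (rule trig_poly_of_real_polynomial_function[OF g(1)])
    show "\<bar>\<phi> x - g (cis x)\<bar> < e" for x
      using g(2)[of "cis x"] by (simp add: \<Psi>)
    have "continuous_on UNIV g"
      using g(1) by (simp add: continuous_on_polymonial_function real_polynomial_function_eq)
    then show "continuous_on UNIV (\<lambda>x. g (cis x))"
      by (rule continuous_on_compose2) (auto intro: continuous_intros)
  qed
qed

lemma has_integral_trig_poly_eq_0:
  assumes "trig_poly p" "f absolutely_integrable_on {0..2 * pi}" "\<And>n. fourier_coeff f n = 0"
  shows "((\<lambda>x. of_real (f x) * p x) has_integral 0) {0..2 * pi}"
  using assms(1)
proof (induction p)
  case (cis n)
  show ?case
    using has_integral_fourier_coeff[OF assms(2), of "- n"] by (simp add: assms(3))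
next
  case (scale p c)
  from has_integral_mult_right[OF scale.IH, of c] show ?case
    by (simp add: mult.left_commute)
next
  case (add p q)
  from has_integral_add[OF add.IH] show ?case
    by (simp add: distrib_left)
qed

text \<open>Uniqueness of Fourier coefficients in tested form: uniform approximation of the test
  function suffices, and no almost everywhere equality has to be derived.\<close>

lemma integral_eq_0_of_fourier_coeff_eq_0:
  assumes f: "f absolutely_integrable_on {0..2 * pi}" and "\<And>n. fourier_coeff f n = 0"
    and cont: "continuous_on UNIV \<phi>" and per: "periodic \<phi>"
  shows "integral {0..2 * pi} (\<lambda>x. f x * \<phi> x) = 0"
proof -
  define B where "B = integral {0..2 * pi} (\<lambda>x. \<bar>f x\<bar>)"
  have absf: "(\<lambda>x. \<bar>f x\<bar>) integrable_on {0..2 * pi}"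
    using absolutely_integrable_norm[OF f] by (auto simp: o_def dest: set_lebesgue_integral_eq_integral(1))
  have int: "(\<lambda>x. f x * \<psi> x) integrable_on {0..2 * pi}" if "continuous_on UNIV \<psi>" for \<psi> :: "real \<Rightarrow> real"
    using absolutely_integrable_scaleR_continuous[OF f continuous_on_subset[OF that]]
    by (auto dest: set_lebesgue_integral_eq_integral(1))
  have le: "\<bar>integral {0..2 * pi} (\<lambda>x. f x * \<phi> x)\<bar> \<le> e * B" if e: "e > 0" for e
  proof -
    obtain p where p: "trig_poly (\<lambda>x. of_real (p x))" "\<And>x. \<bar>\<phi> x - p x\<bar> < e" "continuous_on UNIV p"
      using trig_poly_approx[OF cont per e] by blast
    have "((\<lambda>x. f x * p x) has_integral 0) {0..2 * pi}"
      using has_integral_linear[OF has_integral_trig_poly_eq_0[OF p(1) f assms(2)] bounded_linear_Re]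
      by (simp add: o_def)
    then have "integral {0..2 * pi} (\<lambda>x. f x * \<phi> x) = integral {0..2 * pi} (\<lambda>x. f x * \<phi> x - f x * p x)"
      using integral_diff[OF int[OF cont] int[OF p(3)]] by (simp add: integral_unique)
    also have "\<bar>\<dots>\<bar> \<le> integral {0..2 * pi} (\<lambda>x. e * \<bar>f x\<bar>)"
    proof (subst real_norm_def[symmetric], rule integral_norm_bound_integral)
      show "norm (f x * \<phi> x - f x * p x) \<le> e * \<bar>f x\<bar>" for x
      proof -
        have "norm (f x * \<phi> x - f x * p x) = \<bar>\<phi> x - p x\<bar> * \<bar>f x\<bar>"
          by (simp add: abs_mult[symmetric] algebra_simps)
        also have "\<dots> \<le> e * \<bar>f x\<bar>"
          using p(2)[of x] by (intro mult_right_mono) auto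
        finally show ?thesis .
      qed
    qed (use absf int[OF cont] int[OF p(3)] in \<open>auto intro: integrable_diff integrable_on_mult_right\<close>)
    finally show ?thesis
      by (simp add: B_def)
  qed
  have "((\<lambda>e. e * B) \<longlongrightarrow> 0 * B) (at_right 0)"
    by (intro tendsto_intros)
  then have "\<bar>integral {0..2 * pi} (\<lambda>x. f x * \<phi> x)\<bar> \<le> 0 * B"
    by (rule tendsto_lowerbound) (use le in \<open>auto intro: eventually_mono[OF eventually_at_right_less]\<close>)
  then show ?thesis
    by simp
qed

text \<open>The integral of \<open>(cmod (of_real (f x) - p x))\<^sup>2\<close> is nonnegative,
  where \<open>p\<close> is the partial Fourier sum; each cross term and the square of
  \<open>p\<close> integrate to \<open>2 * pi * ?S\<close>. The bound uses a supremum because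
  suprema are what is known of the solution and of its space derivative.\<close>

lemma bessel_inequality:
  fixes f :: "real \<Rightarrow> real"
  assumes cont: "continuous_on {0..2 * pi} f" and bound: "\<And>x. x \<in> {0..2 * pi} \<Longrightarrow> \<bar>f x\<bar> \<le> M"
    and A: "finite A"
  shows "(\<Sum>n\<in>A. (cmod (fourier_coeff f n))\<^sup>2) \<le> M\<^sup>2"
proof -
  define c where "c n = fourier_coeff f n" for n
  define p where "p x = (\<Sum>n\<in>A. c n * cis (of_int n * x))" for x
  let ?S = "\<Sum>n\<in>A. (cmod (c n))\<^sup>2"
  have f: "f absolutely_integrable_on {0..2 * pi}"
    by (rule absolutely_integrable_continuous_real[OF cont])
  have cp: "((\<lambda>x. of_real (f x) * cnj (p x)) has_integral of_real (2 * pi * ?S)) {0..2 * pi}"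
  proof -
    have "((\<lambda>x. \<Sum>n\<in>A. cnj (c n) * (of_real (f x) * cis (- (of_int n * x)))) has_integral
        (\<Sum>n\<in>A. cnj (c n) * (of_real (2 * pi) * c n))) {0..2 * pi}"
      unfolding c_def by (intro has_integral_sum A has_integral_mult_right has_integral_fourier_coeff f)
    moreover have "(\<Sum>n\<in>A. cnj (c n) * (of_real (2 * pi) * c n)) = of_real (2 * pi * ?S)"
      by (simp add: sum_distrib_left complex_norm_square mult_ac del: of_real_power)
    ultimately show ?thesis
      by (simp add: p_def cis_cnj sum_distrib_left mult_ac)
  qed
  have pp: "((\<lambda>x. p x * cnj (p x)) has_integral of_real (2 * pi * ?S)) {0..2 * pi}"
  proof -
    have "((\<lambda>x. \<Sum>n\<in>A. \<Sum>k\<in>A. c n * cnj (c k) * cis (of_int (n - k) * x)) has_integral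
        (\<Sum>n\<in>A. \<Sum>k\<in>A. c n * cnj (c k) * (if n - k = 0 then of_real (2 * pi) else 0))) {0..2 * pi}"
      by (intro has_integral_sum A has_integral_mult_right has_integral_cis)
    moreover have "(\<Sum>n\<in>A. \<Sum>k\<in>A. c n * cnj (c k) * (if n - k = 0 then of_real (2 * pi) else 0)) =
        of_real (2 * pi * ?S)"
      using A by (simp add: if_distrib[of "(*) _"] sum.delta' sum_distrib_left complex_norm_square mult_ac
          del: of_real_power cong: if_cong)
    moreover have "p x * cnj (p x) = (\<Sum>n\<in>A. \<Sum>k\<in>A. c n * cnj (c k) * cis (of_int (n - k) * x))" for x
    proof -
      have "c n * cis (of_int n * x) * (cnj (c k) * cis (- (of_int k * x))) =
          c n * cnj (c k) * cis (of_int (n - k) * x)" for n k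
        using cis_mult[of "of_int n * x" "- (of_int k * x)"] by (simp add: algebra_simps)
      then show ?thesis
        by (simp only: p_def cnj_sum complex_cnj_mult cis_cnj sum_product)
    qed
    ultimately show ?thesis
      by simp
  qed
  have ff: "((\<lambda>x. of_real ((f x)\<^sup>2)) has_integral of_real (integral {0..2 * pi} (\<lambda>x. (f x)\<^sup>2))) {0..2 * pi}"
    using has_integral_linear[OF integrable_integral[OF integrable_continuous_real[OF continuous_on_power[OF cont]]]
        bounded_linear_of_real, of 2] by (simp add: o_def)
  have int: "((\<lambda>x. of_real ((f x)\<^sup>2) - of_real (f x) * cnj (p x) - cnj (of_real (f x) * cnj (p x)) + p x * cnj (p x))
      has_integral of_real (integral {0..2 * pi} (\<lambda>x. (f x)\<^sup>2)) - of_real (2 * pi * ?S)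
        - cnj (of_real (2 * pi * ?S)) + of_real (2 * pi * ?S)) {0..2 * pi}"
    by (intro has_integral_add has_integral_diff ff cp pp has_integral_cnj)
  have eq: "Re (of_real ((f x)\<^sup>2) - of_real (f x) * cnj (p x) - cnj (of_real (f x) * cnj (p x)) + p x * cnj (p x))
      = (cmod (of_real (f x) - p x))\<^sup>2" for x
    unfolding cmod_power2 by (simp add: power2_eq_square algebra_simps)
  have "((\<lambda>x. (cmod (of_real (f x) - p x))\<^sup>2) has_integral
      integral {0..2 * pi} (\<lambda>x. (f x)\<^sup>2) - 2 * pi * ?S) {0..2 * pi}"
    using has_integral_linear[OF int bounded_linear_Re] unfolding o_def eq by (simp add: mult.assoc)
  then have "0 \<le> integral {0..2 * pi} (\<lambda>x. (f x)\<^sup>2) - 2 * pi * ?S"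
    by (rule has_integral_nonneg) simp
  then have "2 * pi * ?S \<le> integral {0..2 * pi} (\<lambda>x. (f x)\<^sup>2)"
    by simp
  also have "\<dots> \<le> integral {0..2 * pi} (\<lambda>x. M\<^sup>2)"
  proof (rule integral_le)
    show "(f x)\<^sup>2 \<le> M\<^sup>2" if "x \<in> {0..2 * pi}" for x
      using power_mono[OF bound[OF that], of 2] by simp
  qed (auto intro!: integrable_continuous_real continuous_intros cont)
  finally show ?thesis
    by (simp add: c_def)
qed

lemma fourier_coeff_deriv:
  assumes "\<And>x. (f has_real_derivative f' x) (at x)" "continuous_on UNIV f'" "periodic f"
  shows "fourier_coeff f' n = \<i> * of_int n * fourier_coeff f n"
proof (rule fourier_coeffI)
  have contf: "continuous_on {0..2 * pi} f"
    using assms(1) by (meson DERIV_isCont continuous_at_imp_continuous_on)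
  show "f' absolutely_integrable_on {0..2 * pi}"
    using assms(2) continuous_on_subset by (blast intro: absolutely_integrable_continuous_real)
  let ?e = "\<lambda>x. cis (- (of_int n * x))"
  have "((\<lambda>x. of_real (f x) * ?e x) has_vector_derivative
      of_real (f' x) * ?e x + of_real (f x) * (- (\<i> * of_int n * ?e x))) (at x within S)" for x S
  proof -
    have 1: "((\<lambda>x. complex_of_real (f x)) has_vector_derivative of_real (f' x)) (at x within S)"
      using assms(1) by (intro has_vector_derivative_of_real has_vector_derivative_at_within)
        (simp add: has_real_derivative_iff_has_vector_derivative)
    have 2: "(?e has_vector_derivative (- of_int n) *\<^sub>R (\<i> * ?e x)) (at x within S)"
      by (auto intro!: derivative_eq_intros simp: has_vector_derivative_def scaleR_conv_of_real mult_ac)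
    show ?thesis
      using has_vector_derivative_mult[OF 1 2] by (simp add: scaleR_conv_of_real mult_ac add_ac)
  qed
  then have *: "((\<lambda>x. of_real (f' x) * ?e x + of_real (f x) * (- (\<i> * of_int n * ?e x))) has_integral
      of_real (f (2 * pi)) * ?e (2 * pi) - of_real (f 0) * ?e 0) {0..2 * pi}"
    by (intro fundamental_theorem_of_calculus) auto
  have "f (2 * pi) = f 0"
    using assms(3)[unfolded periodic_def, rule_format, of 0] by simp
  moreover have "?e (2 * pi) = 1"
    using cis_multiple_2pi[of "- of_int n"] by (simp add: mult_ac)
  ultimately have "((\<lambda>x. of_real (f' x) * ?e x + of_real (f x) * (- (\<i> * of_int n * ?e x))) has_integral 0)
      {0..2 * pi}"
    using * by simp
  from has_integral_add[OF this has_integral_mult_right[OF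
      has_integral_fourier_coeff[OF absolutely_integrable_continuous_real[OF contf], of n], of "\<i> * of_int n"]]
  show "((\<lambda>x. of_real (f' x) * ?e x) has_integral of_real (2 * pi) * (\<i> * of_int n * fourier_coeff f n))
      {0..2 * pi}"
    by (simp add: algebra_simps)
qed

lemma sum_half_derivative_le:
  assumes "\<And>x. (f has_real_derivative f' x) (at x)" "continuous_on UNIV f'" "periodic f"
    and M: "\<And>x. \<bar>f x\<bar> \<le> M" and L: "\<And>x. \<bar>f' x\<bar> \<le> L" and A: "finite A"
  shows "(\<Sum>n\<in>A. \<bar>of_int n\<bar> * (cmod (fourier_coeff f n))\<^sup>2) \<le> M * L"
proof -
  have contf: "continuous_on {0..2 * pi} f"
    using assms(1) by (meson DERIV_isCont continuous_at_imp_continuous_on)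
  have contf': "continuous_on {0..2 * pi} f'"
    using assms(2) continuous_on_subset by blast
  have "(\<Sum>n\<in>A. \<bar>of_int n\<bar> * (cmod (fourier_coeff f n))\<^sup>2)\<^sup>2 =
      (\<Sum>n\<in>A. cmod (fourier_coeff f n) * cmod (fourier_coeff f' n))\<^sup>2"
    by (simp add: fourier_coeff_deriv[OF assms(1-3)] norm_mult power2_eq_square mult_ac)
  also have "\<dots> \<le> (\<Sum>n\<in>A. (cmod (fourier_coeff f n))\<^sup>2) * (\<Sum>n\<in>A. (cmod (fourier_coeff f' n))\<^sup>2)"
    by (rule Cauchy_Schwarz_ineq_sum)
  also have "\<dots> \<le> M\<^sup>2 * L\<^sup>2"
    using M L by (intro mult_mono bessel_inequality contf contf' A sum_nonneg) auto
  finally have "(\<Sum>n\<in>A. \<bar>of_int n\<bar> * (cmod (fourier_coeff f n))\<^sup>2)\<^sup>2 \<le> (M * L)\<^sup>2"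
    by (simp add: power_mult_distrib)
  moreover have "0 \<le> M * L"
    using M[of 0] L[of 0] by simp
  ultimately show ?thesis
    by (rule power2_le_imp_le)
qed

section \<open>The weak formulation\<close>

text \<open>This is the derivative of the imaginary part of a logarithm; the quotient rule avoids
  the choice of a branch.\<close>

lemma has_real_derivative_arctan_quotient:
  fixes g :: "real \<Rightarrow> complex"
  assumes g: "(g has_vector_derivative g') (at x)" and pos: "0 < Re (g x)"
  shows "((\<lambda>x. arctan (Im (g x) / Re (g x))) has_real_derivative Im (g' / g x)) (at x)"
proof -
  have R: "((\<lambda>x. Re (g x)) has_real_derivative Re g') (at x)"
    and I: "((\<lambda>x. Im (g x)) has_real_derivative Im g') (at x)"
    unfolding has_real_derivative_iff_has_vector_derivative
    by (auto intro: bounded_linear.has_vector_derivative[OF bounded_linear_Re g]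
        bounded_linear.has_vector_derivative[OF bounded_linear_Im g])
  have "((\<lambda>x. arctan (Im (g x) / Re (g x))) has_real_derivative
      inverse (1 + (Im (g x) / Re (g x))\<^sup>2) *
        ((Im g' * Re (g x) - Im (g x) * Re g') / (Re (g x) * Re (g x)))) (at x)"
    using pos by (intro DERIV_chain2[OF DERIV_arctan] DERIV_divide R I) auto
  moreover have "inverse (1 + (i / r)\<^sup>2) * ((i' * r - i * r') / (r * r)) = (i' * r - r' * i) / (r\<^sup>2 + i\<^sup>2)"
    if "r > 0" for r i r' i' :: real
  proof -
    have "1 + (i / r)\<^sup>2 = (r\<^sup>2 + i\<^sup>2) / r\<^sup>2"
      using that by (simp add: power_divide add_divide_distrib)
    then show ?thesis
      using that by (simp add: power2_eq_square mult.commute)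
  qed
  ultimately show ?thesis
    using pos by (simp add: Im_divide)
qed

lemma test_functionE:
  assumes "test_function T \<phi>"
  obtains \<phi>t \<phi>x T' where
    "continuous_on ({0..<T} \<times> UNIV) (\<lambda>(t, x). \<phi> t x)"
    "continuous_on ({0..<T} \<times> UNIV) (\<lambda>(t, x). \<phi>t t x)"
    "continuous_on ({0..<T} \<times> UNIV) (\<lambda>(t, x). \<phi>x t x)"
    "\<And>t x. t \<in> {0..<T} \<Longrightarrow> ((\<lambda>t. \<phi> t x) has_vector_derivative \<phi>t t x) (at t within {0..<T})"
    "\<And>t x. t \<in> {0..<T} \<Longrightarrow> (\<phi> t has_real_derivative \<phi>x t x) (at x)"
    "\<And>t. t \<in> {0..<T} \<Longrightarrow> periodic (\<phi> t)"
    "T' \<in> {0..<T}" "\<And>t x. t \<in> {T'<..<T} \<Longrightarrow> \<phi> t x = 0"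
proof -
  let ?S = "{0..<T} \<times> (UNIV :: real set)" and ?f = "\<lambda>(t, x). \<phi> t x"
  have "cont_diff_on (Suc 0) ?f ?S" "cont_diff_on 0 ?f ?S"
    using assms unfolding test_function_def by blast+
  then obtain f1 f2 where
    f: "\<And>p. p \<in> ?S \<Longrightarrow> (?f has_derivative (\<lambda>h. f1 p * fst h + f2 p * snd h)) (at p within ?S)"
    "continuous_on ?S f1" "continuous_on ?S f2" "continuous_on ?S ?f"
    by auto
  obtain T' where T': "T' \<in> {0..<T}" "\<And>t x. t \<in> {T'<..<T} \<Longrightarrow> \<phi> t x = 0"
    using assms unfolding test_function_def by blast
  show ?thesis
  proof (rule that[of "\<lambda>t x. f1 (t, x)" "\<lambda>t x. f2 (t, x)", OF f(4) _ _ _ _ _ T'])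
    show "((\<lambda>t. \<phi> t x) has_vector_derivative f1 (t, x)) (at t within {0..<T})" if "t \<in> {0..<T}" for t x
    proof -
      have "((\<lambda>t. ?f (t, x)) has_derivative (\<lambda>h. f1 (t, x) * fst (h, 0::real) + f2 (t, x) * snd (h, 0::real)))
          (at t within {0..<T})"
        by (rule has_derivative_in_compose2[OF f(1), of "\<lambda>t. (t, x)" "{0..<T}"])
           (use that in \<open>auto intro!: derivative_eq_intros\<close>)
      then show ?thesis
        by (simp add: has_vector_derivative_def mult.commute)
    qed
    show "(\<phi> t has_real_derivative f2 (t, x)) (at x)" if "t \<in> {0..<T}" for t x
    proof -
      have "((\<lambda>x. ?f (t, x)) has_derivative (\<lambda>h. f1 (t, x) * fst (0::real, h) + f2 (t, x) * snd (0::real, h)))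
          (at x within UNIV)"
        by (rule has_derivative_in_compose2[OF f(1), of "\<lambda>x. (t, x)" UNIV])
           (use that in \<open>auto intro!: derivative_eq_intros\<close>)
      then show ?thesis
        by (simp add: has_field_derivative_def)
    qed
  qed (use f assms in \<open>auto simp: test_function_def split_beta\<close>)
qed

section \<open>Boundary values on the circle and the pointwise equation\<close>

context small_datum
begin

definition f :: "real \<Rightarrow> real \<Rightarrow> complex" where "f t x = F t (cis x)"

definition fx :: "real \<Rightarrow> real \<Rightarrow> complex" where "fx t x = \<i> * cis x * F' t (cis x)"

definition u :: "real \<Rightarrow> real \<Rightarrow> real" where "u t x = Re (f t x)"

definition v :: "real \<Rightarrow> real \<Rightarrow> real" where "v t x = arctan (Im (f t x) / Re (f t x))"

lemma f_has_space_derivative: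
  assumes "t > 0"
  shows "(f t has_vector_derivative fx t x) (at x)"
proof -
  have "(F t \<circ> cis has_vector_derivative (\<i> * cis x) * F' t (cis x)) (at x within UNIV)"
  proof (rule field_vector_diff_chain_within)
    show "(cis has_vector_derivative \<i> * cis x) (at x within UNIV)"
      by (auto intro!: derivative_eq_intros simp: has_vector_derivative_def scaleR_conv_of_real mult_ac)
    show "(F t has_field_derivative F' t (cis x)) (at (cis x) within range cis)"
      by (rule DERIV_subset[OF F_has_space_derivative[OF assms]]) auto
  qed
  then show ?thesis
    by (simp add: f_def[abs_def] fx_def o_def)
qed

lemma f_has_time_derivative:
  assumes "t > 0"
  shows "((\<lambda>t. f t x) has_vector_derivative \<i> * fx t x / f t x) (at t)"
  using F_has_time_derivative[OF assms, of "cis x"] by (simp add: f_def fx_def mult_ac flip: mult.assoc)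

lemma continuous_on_f: "continuous_on ({0..} \<times> UNIV) (\<lambda>(t, x). f t x)"
proof -
  have "continuous_on ({0..} \<times> UNIV) (\<lambda>p. (\<lambda>(t, w). F t w) (fst p, cis (snd p)))"
    by (rule continuous_on_compose2[OF continuous_on_F]) (auto intro!: continuous_intros)
  then show ?thesis
    by (simp add: f_def split_beta)
qed

lemma continuous_on_fx: "continuous_on ({0<..} \<times> UNIV) (\<lambda>(t, x). fx t x)"
proof -
  have "continuous_on ({0<..} \<times> UNIV) (\<lambda>p. (\<lambda>(t, w). F' t w) (fst p, cis (snd p)))"
    by (rule continuous_on_compose2[OF continuous_on_F']) (auto intro!: continuous_intros)
  then have "continuous_on ({0<..} \<times> UNIV) (\<lambda>p. F' (fst p) (cis (snd p)))"
    by simp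
  then show ?thesis
    unfolding fx_def split_beta by (intro continuous_intros)
qed

lemma Re_f_pos: "t \<ge> 0 \<Longrightarrow> 0 < Re (f t x)"
  by (simp add: f_def Re_F_pos)

lemma f_nonzero: "t \<ge> 0 \<Longrightarrow> f t x \<noteq> 0"
  using Re_f_pos[of t x] by auto

lemma continuous_on_u: "continuous_on ({0..} \<times> UNIV) (\<lambda>(t, x). u t x)"
  using continuous_on_f unfolding u_def split_beta by (intro continuous_intros)

lemma continuous_on_v: "continuous_on ({0..} \<times> UNIV) (\<lambda>(t, x). v t x)"
  using continuous_on_f Re_f_pos unfolding v_def split_beta
  by (intro continuous_intros) (auto simp: less_imp_neq[THEN not_sym])

lemma periodic_u: "periodic (u t)"
  by (simp add: periodic_def u_def f_def flip: cis_mult)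

lemma u_has_space_derivative:
  "t > 0 \<Longrightarrow> (u t has_real_derivative Re (fx t x)) (at x)"
  unfolding u_def has_real_derivative_iff_has_vector_derivative
  by (intro bounded_linear.has_vector_derivative[OF bounded_linear_Re] f_has_space_derivative)

lemma u_has_time_derivative:
  "t > 0 \<Longrightarrow> ((\<lambda>t. u t x) has_vector_derivative - Im (fx t x / f t x)) (at t)"
  using bounded_linear.has_vector_derivative[OF bounded_linear_Re f_has_time_derivative, of t x]
  by (simp add: u_def flip: times_divide_eq_right)

text \<open>The time derivative of \<open>u\<close> is the same expression with opposite sign, so
  the conservation law with flux \<open>v\<close> holds pointwise for t > 0.\<close>

lemma v_has_space_derivative:
  "t > 0 \<Longrightarrow> (v t has_real_derivative Im (fx t x / f t x)) (at x)"
  unfolding v_def by (intro has_real_derivative_arctan_quotient f_has_space_derivative Re_f_pos less_imp_le)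

lemma hilbert_u:
  assumes "t > 0"
  shows "(hilbert_truncated (u t) x \<longlongrightarrow> Im (f t x)) (at_right 0)"
  unfolding u_def f_def
proof (rule hilbert_truncated_boundary[OF _ F_holomorphic[OF assms] F_has_space_derivative[OF assms]])
  show "continuous_on (cball 0 1) (F t)"
    using F_has_space_derivative[OF assms] by (intro DERIV_continuous_on) auto
  show "Im (F t 0) = 0"
    using assms by (simp add: F_zero)
qed simp

lemma flux_u: "t > 0 \<Longrightarrow> flux u t x = v t x"
  using tendsto_Lim[OF trivial_limit_at_right_real hilbert_u, of t x]
  by (simp add: flux_def hilbert_def v_def u_def)

text \<open>The pairing \<open>G t\<close> of \<open>u t\<close> with the test function has
  derivative \<open>J t\<close> for t > 0, is continuous at 0 and vanishes near T, so integrating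
  \<open>J\<close> in time leaves \<open>- G 0\<close>. The right-hand side is the pairing with
  \<open>u 0\<close>, not yet with the given datum.\<close>

lemma weak_identity:
  assumes "test_function T \<phi>"
  shows "- (LINT s:{0..<T}|lebesgue. LINT x:{0..2*pi}|lebesgue.
            u s x * vector_derivative (\<lambda>\<tau>. \<phi> \<tau> x) (at s within {0..<T}) + flux u s x * deriv (\<phi> s) x)
    = integral {0..2*pi} (\<lambda>x. u 0 x * \<phi> 0 x)" (is "- (LINT s:_|_. ?inner s) = _")
proof -
  obtain \<phi>t \<phi>x T' where
    cont: "continuous_on ({0..<T} \<times> UNIV) (\<lambda>(t, x). \<phi> t x)"
      "continuous_on ({0..<T} \<times> UNIV) (\<lambda>(t, x). \<phi>t t x)"
      "continuous_on ({0..<T} \<times> UNIV) (\<lambda>(t, x). \<phi>x t x)"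
    and \<phi>t: "\<And>t x. t \<in> {0..<T} \<Longrightarrow> ((\<lambda>t. \<phi> t x) has_vector_derivative \<phi>t t x) (at t within {0..<T})"
    and \<phi>x: "\<And>t x. t \<in> {0..<T} \<Longrightarrow> (\<phi> t has_real_derivative \<phi>x t x) (at x)"
    and per: "\<And>t. t \<in> {0..<T} \<Longrightarrow> periodic (\<phi> t)"
    and T': "T' \<in> {0..<T}" "\<And>t x. t \<in> {T'<..<T} \<Longrightarrow> \<phi> t x = 0"
    by (rule test_functionE[OF assms]) (rule that; assumption)
  define j where "j t x = u t x * \<phi>t t x + v t x * \<phi>x t x" for t x
  define J where "J t = integral {0..2 * pi} (j t)" for t
  define G where "G t = integral {0..2 * pi} (\<lambda>x. u t x * \<phi> t x)" for t
  note sub = continuous_on_subset[of _ _ "{0..<T} \<times> (UNIV :: real set)"]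
  have contu: "continuous_on ({0..<T} \<times> UNIV) (\<lambda>p. u (fst p) (snd p))"
    and contv: "continuous_on ({0..<T} \<times> UNIV) (\<lambda>p. v (fst p) (snd p))"
    using sub[OF continuous_on_u] sub[OF continuous_on_v] by (force simp: split_beta)+
  have contj: "continuous_on ({0..<T} \<times> UNIV) (\<lambda>(t, x). j t x)"
    using cont unfolding j_def split_beta by (intro continuous_intros contu contv)
  have contu\<phi>: "continuous_on ({0..<T} \<times> UNIV) (\<lambda>(t, x). u t x * \<phi> t x)"
    using cont unfolding split_beta by (intro continuous_intros contu)
  have slice: "continuous_on A (h t)"
    if "continuous_on ({0..<T} \<times> UNIV) (\<lambda>(t, x). h t x)" "t \<in> {0..<T}" for h :: "real \<Rightarrow> real \<Rightarrow> real" and t A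
  proof -
    have "continuous_on A (\<lambda>x. (\<lambda>(t, x). h t x) (t, x))"
      by (rule continuous_on_compose2[OF that(1)]) (use that(2) in \<open>auto intro!: continuous_intros\<close>)
    then show ?thesis by simp
  qed
  have "continuous_on ({0..<T} \<times> cbox 0 (2 * pi)) (\<lambda>(t, x). j t x)"
    by (rule continuous_on_subset[OF contj]) auto
  from integral_continuous_on_param[OF this] have contJ: "continuous_on {0..<T} J"
    by (simp add: J_def[abs_def])
  have "continuous_on ({0..<T} \<times> cbox 0 (2 * pi)) (\<lambda>(t, x). u t x * \<phi> t x)"
    by (rule continuous_on_subset[OF contu\<phi>]) auto
  from integral_continuous_on_param[OF this] have contG: "continuous_on {0..<T} G"
    by (simp add: G_def[abs_def])
  have G': "(G has_vector_derivative J t) (at t)" if t: "t \<in> {0<..<T}" for t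
  proof -
    let ?d = "\<lambda>t x. u t x * \<phi>t t x + - Im (fx t x / f t x) * \<phi> t x"
    have S: "{0<..<T} \<times> UNIV \<subseteq> {0..<T} \<times> (UNIV :: real set)" "{0<..<T} \<times> UNIV \<subseteq> {0..} \<times> (UNIV :: real set)"
      "{0<..<T} \<times> UNIV \<subseteq> {0<..} \<times> (UNIV :: real set)"
      by auto
    have contd: "continuous_on ({0<..<T} \<times> UNIV) (\<lambda>(t, x). ?d t x)"
      using continuous_on_subset[OF contu S(1)] continuous_on_subset[OF cont(1) S(1)]
        continuous_on_subset[OF cont(2) S(1)] continuous_on_subset[OF continuous_on_f S(2)]
        continuous_on_subset[OF continuous_on_fx S(3)]
      unfolding split_beta by (intro continuous_intros) (auto simp: f_nonzero)
    have "((\<lambda>t. integral (cbox 0 (2 * pi)) (\<lambda>x. u t x * \<phi> t x)) has_vector_derivative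
        integral (cbox 0 (2 * pi)) (?d t)) (at t within {0<..<T})"
    proof (rule leibniz_rule_vector_derivative)
      fix s x :: real assume s: "s \<in> {0<..<T}"
      have "((\<lambda>t. \<phi> t x) has_vector_derivative \<phi>t s x) (at s within {0<..<T})"
        by (rule has_vector_derivative_within_subset[OF \<phi>t]) (use s in auto)
      moreover have "((\<lambda>t. u t x) has_vector_derivative - Im (fx s x / f s x)) (at s within {0<..<T})"
        using s by (intro has_vector_derivative_at_within[OF u_has_time_derivative]) auto
      ultimately show "((\<lambda>t. u t x * \<phi> t x) has_vector_derivative ?d s x) (at s within {0<..<T})"
        by (rule has_vector_derivative_mult[rotated])
    next
      show "(\<lambda>x. u s x * \<phi> s x) integrable_on cbox 0 (2 * pi)" if "s \<in> {0<..<T}" for s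
        using slice[OF contu\<phi>, of s] that by (intro integrable_continuous) auto
      show "continuous_on ({0<..<T} \<times> cbox 0 (2 * pi)) (\<lambda>(t, x). ?d t x)"
        by (rule continuous_on_subset[OF contd]) auto
    qed (use t in auto)
    \<comment> \<open>Integration by parts in space: adding the x-derivative of
      \<open>v t x * \<phi> t x\<close>, whose integral is 0 by periodicity, exchanges the time
      derivative of \<open>u\<close> for the flux term.\<close>
    moreover have "integral {0..2 * pi} (?d t) = J t"
    proof -
      have "((\<lambda>x. Im (fx t x / f t x) * \<phi> t x + v t x * \<phi>x t x) has_integral
          v t (2 * pi) * \<phi> t (2 * pi) - v t 0 * \<phi> t 0) {0..2 * pi}"
      proof (rule fundamental_theorem_of_calculus)
        fix x
        show "((\<lambda>x. v t x * \<phi> t x) has_vector_derivative Im (fx t x / f t x) * \<phi> t x + v t x * \<phi>x t x)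
            (at x within {0..2 * pi})"
        proof -
          have "((\<lambda>x. v t x * \<phi> t x) has_real_derivative
              Im (fx t x / f t x) * \<phi> t x + \<phi>x t x * v t x) (at x within {0..2 * pi})"
            using t by (intro has_field_derivative_at_within[OF DERIV_mult[OF v_has_space_derivative \<phi>x]]) auto
          then show ?thesis
            by (simp only: has_real_derivative_iff_has_vector_derivative mult.commute[of "v t x"])
        qed
      qed auto
      moreover have "\<phi> t (2 * pi) = \<phi> t 0" "v t (2 * pi) = v t 0"
        using per[of t, unfolded periodic_def, rule_format, of 0] t by (simp_all add: v_def f_def)
      ultimately have zero: "((\<lambda>x. Im (fx t x / f t x) * \<phi> t x + v t x * \<phi>x t x) has_integral 0) {0..2 * pi}"
        by simp
      have "?d t integrable_on {0..2 * pi}"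
      proof (intro integrable_continuous_real)
        have "continuous_on {0..2 * pi} (\<lambda>x. (\<lambda>(t, x). ?d t x) (t, x))"
          by (rule continuous_on_compose2[OF contd]) (use t in \<open>auto intro!: continuous_intros\<close>)
        then show "continuous_on {0..2 * pi} (?d t)"
          by simp
      qed
      from has_integral_add[OF integrable_integral[OF this] zero]
      have "(j t has_integral integral {0..2 * pi} (?d t)) {0..2 * pi}"
        by (simp add: j_def[abs_def] algebra_simps)
      then show ?thesis
        by (simp add: J_def integral_unique)
    qed
    ultimately show ?thesis
      using t by (simp add: G_def[abs_def] cbox_interval has_vector_derivative_within_open[OF t])
  qed
  have G0: "G t = 0" if "t \<in> {T'<..<T}" for t
    using T'(2)[OF that] by (simp add: G_def)
  have J0: "J t = 0" if t: "t \<in> {T'<..<T}" for t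
  proof -
    have "((\<lambda>t. 0) has_vector_derivative J t) (at t)"
      by (rule has_vector_derivative_transform_within_open[OF G' open_greaterThanLessThan t])
         (use t T'(1) G0 in auto)
    then show ?thesis
      using vector_derivative_unique_at[OF _ has_vector_derivative_const] by blast
  qed
  have inner: "?inner t = J t" if t: "t \<in> {0<..<T}" for t
  proof -
    have "vector_derivative (\<lambda>\<tau>. \<phi> \<tau> x) (at t within {0..<T}) = \<phi>t t x" for x
    proof (rule vector_derivative_within)
      have "t \<in> interior {0..<T}"
        using t by (simp add: interior_atLeastLessThan)
      then show "at t within {0..<T} \<noteq> bot"
        by (simp add: at_within_interior[of t "{0..<T}"])
    qed (use t \<phi>t in auto)
    moreover have "deriv (\<phi> t) x = \<phi>x t x" for x
      using t \<phi>x by (intro DERIV_imp_deriv) auto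
    ultimately have "?inner t = (LINT x:{0..2*pi}|lebesgue. j t x)"
      using t by (simp add: j_def flux_u)
    also have "\<dots> = J t"
      unfolding J_def using t
      by (intro set_lebesgue_integral_eq_integral absolutely_integrable_continuous_real slice[OF contj]) auto
    finally show ?thesis .
  qed
  \<comment> \<open>A time strictly between \<open>T'\<close> and \<open>T\<close>, so that the
    fundamental theorem applies on a closed interval inside \<open>{0..<T}\<close>.\<close>
  define T'' where "T'' = (T' + T) / 2"
  have T'': "T'' \<in> {T'<..<T}" "0 < T''"
    using T'(1) by (auto simp: T''_def)
  have "(J has_integral G T'' - G 0) {0..T''}"
    by (rule fundamental_theorem_of_calculus_interior)
       (use T'' G' in \<open>auto intro!: continuous_on_subset[OF contG]\<close>)
  then have int: "integral {0..T''} J = - G 0"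
    using G0[OF T''(1)] by (simp add: integral_unique)
  have J: "J absolutely_integrable_on {0..T''}"
    using T'' by (intro absolutely_integrable_continuous_real continuous_on_subset[OF contJ]) auto
  \<comment> \<open>At t = 0 the principal value may fail to exist, so the inner integral is
    identified only away from this negligible point.\<close>
  have eq: "?inner t = J t" if "t \<in> {0..T''} - {0}" for t
    using that T'' by (intro inner) auto
  have empty: "{t \<in> {0..<T} - {0..T''}. ?inner t \<noteq> 0} = {}" "{t \<in> {0..T''} - {0..<T}. ?inner t \<noteq> 0} = {}"
  proof -
    have "?inner t = 0" if "t \<in> {0..<T} - {0..T''}" for t
      using inner[of t] J0[of t] that T'' T'(1) by auto
    then show "{t \<in> {0..<T} - {0..T''}. ?inner t \<noteq> 0} = {}"
      by blast
  qed (use T'' T'(1) in auto)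
  have "?inner absolutely_integrable_on {0..T''}"
    by (rule absolutely_integrable_spike[OF J negligible_sing eq])
  then have "?inner absolutely_integrable_on {0..<T}"
    by (subst absolutely_integrable_spike_set_eq[where T = "{0..T''}"]) (simp_all only: empty negligible_empty)
  then have "(LINT s:{0..<T}|lebesgue. ?inner s) = integral {0..<T} ?inner"
    by (rule set_lebesgue_integral_eq_integral)
  also have "\<dots> = integral {0..T''} ?inner"
    by (rule integral_spike_set) (simp_all only: empty negligible_empty)
  also have "\<dots> = integral {0..T''} J"
    by (rule integral_spike[OF negligible_sing eq[symmetric]])
  finally show ?thesis
    by (simp add: int G_def)
qed

end

section \<open>Integrability and decay\<close>

text \<open>Symmetric intervals are cofinal among the finite sets of integers. They make the sum the
  limit of a sequence, as needed for measurability in time.\<close>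

lemma has_sum_int_LIMSEQ:
  fixes g :: "int \<Rightarrow> 'a::{topological_space, comm_monoid_add}"
  assumes "(g has_sum S) UNIV"
  shows "(\<lambda>k. \<Sum>n\<in>{- int k..int k}. g n) \<longlonglongrightarrow> S"
proof (rule filterlim_compose[OF assms[unfolded has_sum_def]])
  show "filterlim (\<lambda>k. {- int k..int k}) (finite_subsets_at_top UNIV) sequentially"
    unfolding filterlim_finite_subsets_at_top
  proof (intro allI impI)
    fix X :: "int set" assume "finite X \<and> X \<subseteq> UNIV"
    then have K: "\<bar>x\<bar> \<le> (\<Sum>x\<in>X. \<bar>x\<bar>)" if "x \<in> X" for x
      using that by (intro member_le_sum) auto
    show "\<forall>\<^sub>F k in sequentially. finite {- int k..int k} \<and> X \<subseteq> {- int k..int k} \<and> {- int k..int k} \<subseteq> UNIV"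
      using eventually_ge_at_top[of "nat (\<Sum>x\<in>X. \<bar>x\<bar>)"]
    proof eventually_elim
      case (elim k)
      have "x \<in> {- int k..int k}" if "x \<in> X" for x
        using K[OF that] elim by auto
      then show ?case
        by auto
    qed
  qed
qed

lemma sums_of_even_summable:
  fixes a :: "int \<Rightarrow> real"
  assumes "a summable_on UNIV" "\<And>n. a (- n) = a n" "a 0 = 0"
  shows "(\<lambda>n. 2 * a (int (Suc n))) sums (\<Sum>\<^sub>\<infinity>n. a n)"
proof -
  let ?p = "\<lambda>n::nat. int (Suc n)" and ?q = "\<lambda>n::nat. - int (Suc n)"
  have inj: "inj ?p" "inj ?q"
    by (auto simp: inj_def)
  have "n \<in> {0} \<union> range ?p \<union> range ?q" for n
  proof -
    have "n = 0 \<or> n = ?p (nat n - 1) \<or> n = ?q (nat (- n) - 1)"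
      by auto
    then show ?thesis
      by blast
  qed
  then have UNIV: "UNIV = {0} \<union> range ?p \<union> range ?q"
    by blast
  have summable: "a summable_on A" for A
    using summable_on_subset_banach[OF assms(1)] by auto
  have q: "infsum a (range ?q) = infsum a (range ?p)"
    unfolding infsum_reindex[OF inj(1)] infsum_reindex[OF inj(2)] by (simp only: o_def assms(2))
  have "infsum a ({0} \<union> range ?p \<union> range ?q) = infsum a ({0} \<union> range ?p) + infsum a (range ?q)"
    by (rule infsum_Un_disjoint[OF summable summable]) auto
  also have "infsum a ({0} \<union> range ?p) = infsum a {0} + infsum a (range ?p)"
    by (rule infsum_Un_disjoint[OF summable summable]) auto
  finally have "infsum a UNIV = infsum a {0} + infsum a (range ?p) + infsum a (range ?q)"
    unfolding UNIV[symmetric] .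
  then have "infsum a UNIV = 2 * infsum a (range ?p)"
    using q assms(3) by simp
  moreover have "(\<lambda>n. a (?p n)) sums infsum a (range ?p)"
    using has_sum_infsum[OF summable, of "range ?p"] unfolding has_sum_reindex[OF inj(1)] o_def
    by (rule has_sum_imp_sums)
  ultimately show ?thesis
    using sums_mult by fastforce
qed

lemma Linfty_norm_leI:
  assumes "g \<in> borel_measurable M" "\<And>x. x \<in> space M \<Longrightarrow> \<bar>g x\<bar> \<le> c"
  shows "Linfty_norm M g \<le> ereal c"
  unfolding Linfty_norm_def using assms by (intro esssup_I) (auto intro!: AE_I2)

lemma circle_mean_pos:
  assumes f: "f absolutely_integrable_on {0..2 * pi}" and pos: "\<And>x. f x > 0"
  shows "circle_mean f > 0"
proof -
  let ?g = "\<lambda>x. indicator {0..2 * pi} x *\<^sub>R f x"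
  have nonneg: "0 \<le> ?g x" for x
    using pos[of x] by (simp add: indicator_def)
  have "integral\<^sup>L lebesgue ?g \<noteq> 0"
  proof
    assume "integral\<^sup>L lebesgue ?g = 0"
    then have "AE x in lebesgue. ?g x = 0"
      using integral_nonneg_eq_0_iff_AE[OF f[unfolded set_integrable_def]] nonneg by simp
    then have "AE x in lebesgue. x \<notin> {0..2 * pi}"
      by (rule eventually_mono) (simp add: less_imp_neq[OF pos, THEN not_sym] indicator_eq_0_iff)
    then have "negligible {0..2 * pi}"
      by (simp add: negligible_iff_null_sets AE_iff_null_sets)
    then show False
      using negligible_interval(1)[of 0 "2 * pi"] pi_gt_zero by simp
  qed
  then have "integral\<^sup>L lebesgue ?g > 0"
    using integral_nonneg_AE[of ?g lebesgue] nonneg by (simp add: less_le)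
  then show ?thesis
    by (simp add: circle_mean_def set_lebesgue_integral_def)
qed

lemma spacetime_eq_cbox: "{0..T::real} \<times> {0..2 * pi} = cbox (0, 0) (T, 2 * pi)"
  by (simp add: cbox_Pair_eq)

lemma negligible_initial_slice: "negligible ({0::real} \<times> {0..2 * pi})"
proof -
  have "{0} \<times> {0..2 * pi} = cbox (0::real, 0::real) (0, 2 * pi)"
    by (simp add: cbox_Pair_eq)
  moreover have "box (0::real, 0::real) (0, 2 * pi) = {}"
    by (auto simp: box_def Basis_prod_def)
  ultimately show ?thesis
    by (simp only: negligible_interval)
qed

section \<open>Membership in the function spaces, and the initial coefficients\<close>

context small_datum
begin

lemma continuous_on_spacetime:
  assumes "continuous_on ({0..} \<times> UNIV) (\<lambda>(t, x). g t x)"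
  shows "continuous_on ({0..T} \<times> {0..2 * pi}) (\<lambda>(t, x). g t x)"
  by (rule continuous_on_subset[OF assms]) auto

lemma absolutely_integrable_spacetime:
  fixes g :: "real \<Rightarrow> real \<Rightarrow> real"
  assumes "continuous_on ({0..} \<times> UNIV) (\<lambda>(t, x). g t x)"
  shows "(\<lambda>(t, x). g t x) absolutely_integrable_on ({0..T} \<times> {0..2 * pi})"
  using continuous_on_spacetime[OF assms] unfolding spacetime_eq_cbox
  by (rule absolutely_integrable_continuous)

lemma flux_integrable:
  "(\<lambda>(t, x). flux u t x) absolutely_integrable_on ({0..T} \<times> {0..2 * pi})"
  by (rule absolutely_integrable_spike[OF absolutely_integrable_spacetime[OF continuous_on_v] negligible_initial_slice])
     (auto, metis flux_u less_eq_real_def)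

lemma AE_hilbert_exists:
  "AE (t, x) in lebesgue_on ({0..T} \<times> {0..2 * pi}). u t x \<noteq> 0 \<and> hilbert_exists (u t) x"
proof -
  have "{0::real} \<times> {0..2 * pi} \<in> null_sets lebesgue"
    using negligible_initial_slice by (simp add: negligible_iff_null_sets)
  then have "AE p in lebesgue. p \<notin> {0::real} \<times> {0..2 * pi}"
    by (rule AE_not_in)
  then have "AE p in lebesgue. p \<in> {0..T} \<times> {0..2 * pi} \<longrightarrow>
      (case p of (t, x) \<Rightarrow> u t x \<noteq> 0 \<and> hilbert_exists (u t) x)"
  proof eventually_elim
    case (elim p)
    show ?case
    proof (cases p)
      case (Pair t x)
      have "u t x \<noteq> 0" "hilbert_exists (u t) x" if "t > 0"
        using Re_f_pos[of t x] hilbert_u[OF that, of x] that by (auto simp: u_def hilbert_exists_def)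
      then show ?thesis
        using elim Pair by fastforce
    qed
  qed
  then show ?thesis
    by (subst AE_restrict_space_iff) (simp_all add: spacetime_eq_cbox)
qed

lemma abs_u_le: "t \<ge> 0 \<Longrightarrow> \<bar>u t x\<bar> \<le> 2 * m"
  using abs_Re_le_cmod[of "f t x"] norm_F_le[of t "cis x"] by (simp add: u_def f_def)

lemma abs_u_minus_mean_le: "t \<ge> 0 \<Longrightarrow> \<bar>u t x - m\<bar> \<le> \<beta> * radius t"
  using abs_Re_le_cmod[of "f t x - of_real m"] norm_F_minus_mean_le[of t "cis x"] by (simp add: u_def f_def)

lemma abs_ux_le: "t > 0 \<Longrightarrow> \<bar>Re (fx t x)\<bar> \<le> speed t"
  using abs_Re_le_cmod[of "fx t x"] norm_F'_le[of t "cis x"] by (simp add: fx_def norm_mult)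

lemma continuous_on_ux: "t > 0 \<Longrightarrow> continuous_on UNIV (\<lambda>x. Re (fx t x))"
  using continuous_on_compose2[OF continuous_on_fx, of UNIV "\<lambda>x. (t, x)"]
  by (force intro: continuous_intros)

lemma continuous_on_u_slice: "t \<ge> 0 \<Longrightarrow> continuous_on A (u t)"
  using continuous_on_compose2[OF continuous_on_u, of A "\<lambda>x. (t, x)"]
  by (force intro: continuous_intros)

lemma in_Linfty_u: "in_Linfty T u"
proof -
  have meas: "(\<lambda>(t, x). u t x) \<in> borel_measurable (lebesgue_on ({0..T} \<times> {0..2 * pi}))"
    using continuous_on_spacetime[OF continuous_on_u] unfolding spacetime_eq_cbox
    by (rule continuous_imp_measurable_on_sets_lebesgue) simp
  then have "Linfty_norm (lebesgue_on ({0..T} \<times> {0..2 * pi})) (\<lambda>(t, x). u t x) \<le> ereal (2 * m)"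
    by (rule Linfty_norm_leI) (auto simp: abs_u_le)
  then show ?thesis
    using meas by (auto simp: in_Linfty_def)
qed

lemma Linfty_norm_u_minus_mean_le:
  assumes "t \<ge> 0"
  shows "Linfty_norm (lebesgue_on {0..2 * pi}) (\<lambda>x. u t x - m) \<le> ereal (\<beta> * radius t)"
proof (rule Linfty_norm_leI)
  show "(\<lambda>x. u t x - m) \<in> borel_measurable (lebesgue_on {0..2 * pi})"
    by (intro continuous_imp_measurable_on_sets_lebesgue continuous_intros continuous_on_u_slice assms) simp
qed (use abs_u_minus_mean_le[OF assms] in auto)

lemma u_absolutely_integrable: "t \<ge> 0 \<Longrightarrow> u t absolutely_integrable_on {0..2 * pi}"
  by (intro absolutely_integrable_continuous_real continuous_on_u_slice)

definition energy :: "real \<Rightarrow> int \<Rightarrow> real" where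
  "energy t n = \<bar>of_int n\<bar> * (cmod (fourier_coeff (u t) n))\<^sup>2"

lemma sum_energy_le: "t > 0 \<Longrightarrow> finite A \<Longrightarrow> sum (energy t) A \<le> 2 * m * speed t"
  unfolding energy_def
  by (rule sum_half_derivative_le[OF u_has_space_derivative continuous_on_ux periodic_u abs_u_le abs_ux_le]) auto

lemma summable_energy: "t > 0 \<Longrightarrow> energy t summable_on UNIV"
  by (rule nonneg_bounded_partial_sums_imp_summable_on[where C = "2 * m * speed t"])
     (auto simp: energy_def intro!: eventually_finite_subsets_at_top_weakI sum_energy_le[unfolded energy_def])

lemma infsum_energy_le: "t > 0 \<Longrightarrow> infsum (energy t) UNIV \<le> 2 * m * speed t"
  by (intro infsum_le_finite_sums summable_energy sum_energy_le)

lemma infsum_energy_nonneg: "0 \<le> infsum (energy t) UNIV"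
  by (rule infsum_nonneg) (simp add: energy_def)

lemma freq_weight_half: "(\<lambda>n. freq_weight (2 * (1 / 2)) n * (cmod (fourier_coeff (u t) n))\<^sup>2) = energy t"
  by (simp add: fun_eq_iff freq_weight_def energy_def)

lemma u_in_sobolev_space: "t > 0 \<Longrightarrow> u t \<in> sobolev_space (1 / 2)"
  unfolding sobolev_space_def mem_Collect_eq freq_weight_half
  by (intro conjI periodic_u u_absolutely_integrable summable_energy) auto

lemma sobolev_norm_u: "(sobolev_norm (1 / 2) (u t))\<^sup>2 = 2 * pi * infsum (energy t) UNIV"
  unfolding sobolev_norm_def freq_weight_half by (simp add: infsum_energy_nonneg)

text \<open>Single frequencies stay continuous down to t = 0 even if their sum diverges there, so
  the Sobolev norm is a limit of continuous functions for t > 0.\<close>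

lemma continuous_on_energy: "continuous_on {0..T} (\<lambda>t. energy t n)"
proof -
  have "continuous_on ({0..T} \<times> cbox 0 (2 * pi)) (\<lambda>(t, x). of_real (u t x) * cis (- (of_int n * x)))"
    using continuous_on_spacetime[OF continuous_on_u, of T] unfolding split_beta
    by (intro continuous_intros) simp
  from integral_continuous_on_param[OF this]
  have "continuous_on {0..T} (\<lambda>t. integral {0..2 * pi} (\<lambda>x. of_real (u t x) * cis (- (of_int n * x))))"
    by simp
  from continuous_on_mult_left[OF this, of "1 / of_real (2 * pi)"]
  have "continuous_on {0..T} (\<lambda>t. fourier_coeff (u t) n)"
    by (rule continuous_on_eq)
       (simp add: integral_unique[OF has_integral_fourier_coeff[OF u_absolutely_integrable]])
  then show ?thesis
    unfolding energy_def by (intro continuous_intros)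
qed

lemma in_L2_sobolev_u:
  assumes "T > 0"
  shows "in_L2_sobolev T (1 / 2) u"
proof -
  \<comment> \<open>Time 0 is cut out because the sum may diverge there: \<open>infsum\<close> is
    then 0 and not the limit of the symmetric partial sums. The majorant is reset at 0 since
    \<open>speed 0\<close> is not controlled either.\<close>
  define N where "N t = indicator (- {0}) t * (2 * pi * infsum (energy t) UNIV)" for t :: real
  have "N absolutely_integrable_on {0..T}"
  proof (rule measurable_bounded_by_integrable_imp_absolutely_integrable)
    show "N \<in> borel_measurable (lebesgue_on {0..T})"
    proof (rule borel_measurable_LIMSEQ_metric)
      show "(\<lambda>t. indicator (- {0}) t * (2 * pi * (\<Sum>n\<in>{- int k..int k}. energy t n)))
          \<in> borel_measurable (lebesgue_on {0..T})" for k
      proof (rule borel_measurable_times)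
        have "(indicator (- {0}) :: real \<Rightarrow> real) \<in> borel_measurable lebesgue"
          by (rule borel_measurable_indicator) (auto intro: borel_open)
        then show "(indicator (- {0}) :: real \<Rightarrow> real) \<in> borel_measurable (lebesgue_on {0..T})"
          by (rule measurable_restrict_space1)
        show "(\<lambda>t. 2 * pi * (\<Sum>n\<in>{- int k..int k}. energy t n)) \<in> borel_measurable (lebesgue_on {0..T})"
          by (intro continuous_imp_measurable_on_sets_lebesgue continuous_intros continuous_on_energy) simp
      qed
      fix t assume "t \<in> space (lebesgue_on {0..T})"
      then consider "t = 0" | "t > 0"
        by fastforce
      then show "(\<lambda>k. indicator (- {0}) t * (2 * pi * (\<Sum>n\<in>{- int k..int k}. energy t n))) \<longlonglongrightarrow> N t"
      proof cases
        case 2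
        then show ?thesis
          unfolding N_def
          by (intro tendsto_intros has_sum_int_LIMSEQ has_sum_infsum summable_energy)
      qed (simp add: N_def)
    qed
    show "(\<lambda>t. if t = 0 then 0 else 2 * pi * (2 * m * speed t)) integrable_on {0..T}"
      by (rule integrable_spike[OF _ negligible_sing[of 0]])
         (auto intro!: integrable_on_mult_right speed_integrable assms)
    show "norm (N t) \<le> (if t = 0 then 0 else 2 * pi * (2 * m * speed t))" if "t \<in> {0..T}" for t
      using that infsum_energy_le[of t] infsum_energy_nonneg[of t] by (auto simp: N_def abs_mult)
  qed simp
  then have "(\<lambda>t. (sobolev_norm (1 / 2) (u t))\<^sup>2) absolutely_integrable_on {0..T}"
    by (rule absolutely_integrable_spike[OF _ negligible_sing[of 0]]) (simp add: N_def sobolev_norm_u)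
  moreover have "AE t in lebesgue_on {0..T}. u t \<in> sobolev_space (1 / 2)"
  proof -
    have "AE t in lebesgue. t \<notin> {0::real}"
      by (rule AE_not_in) (simp flip: negligible_iff_null_sets)
    then have "AE t in lebesgue. t \<in> {0..T} \<longrightarrow> u t \<in> sobolev_space (1 / 2)"
      by eventually_elim (auto intro!: u_in_sobolev_space)
    then show ?thesis
      by (subst AE_restrict_space_iff) auto
  qed
  ultimately show ?thesis
    using in_Linfty_u by (simp add: in_L2_sobolev_def in_Linfty_def)
qed

text \<open>The series converges uniformly on the circle and may be integrated term by term. Only
  nonnegative frequencies occur, and the coefficient of frequency n > 0 is
  \<open>b (nat n - 1)\<close>.\<close>

lemma has_integral_F0_fourier:
  "((\<lambda>x. F0 (cis x) * cis (- (of_int n * x))) has_integral of_real (2 * pi) *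
    (if n = 0 then of_real m else if n > 0 then b (nat n - 1) else 0)) {0..2 * pi}"
proof -
  define d where "d i = b i * (if int (Suc i) - n = 0 then of_real (2 * pi) else 0)" for i
  have "uniform_limit {0..2 * pi} (\<lambda>N x. \<Sum>i<N. b i * cis (of_int (int (Suc i) - n) * x))
      (\<lambda>x. \<Sum>i. b i * cis (of_int (int (Suc i) - n) * x)) sequentially"
    by (rule Weierstrass_m_test[OF _ summable_b]) (simp add: norm_mult)
  then obtain I L where I: "\<And>N. ((\<lambda>x. \<Sum>i<N. b i * cis (of_int (int (Suc i) - n) * x)) has_integral I N) {0..2 * pi}"
    and L: "((\<lambda>x. \<Sum>i. b i * cis (of_int (int (Suc i) - n) * x)) has_integral L) {0..2 * pi}" "I \<longlonglongrightarrow> L"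
    by (rule uniform_limit_integral) (intro continuous_intros, simp, blast)
  have "((\<lambda>x. \<Sum>i<N. b i * cis (of_int (int (Suc i) - n) * x)) has_integral (\<Sum>i<N. d i)) {0..2 * pi}" for N
    unfolding d_def by (intro has_integral_sum has_integral_mult_right has_integral_cis) simp
  then have "I = (\<lambda>N. \<Sum>i<N. d i)"
    using I has_integral_unique by blast
  with L(2) have "d sums L"
    by (simp add: sums_def)
  moreover have "d sums (of_real (2 * pi) * (if n > 0 then b (nat n - 1) else 0))"
  proof (cases "n > 0")
    case True
    have "d = (\<lambda>i. if i = nat n - 1 then of_real (2 * pi) * b i else 0)"
      using True by (auto simp: d_def fun_eq_iff)
    then show ?thesis
      using True sums_single[of "nat n - 1" "\<lambda>i. of_real (2 * pi) * b i"] by simp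
  next
    case False
    then have "d = (\<lambda>i. 0)"
      by (auto simp: d_def fun_eq_iff)
    then show ?thesis
      using False by simp
  qed
  ultimately have Leq: "L = of_real (2 * pi) * (if n > 0 then b (nat n - 1) else 0)"
    by (rule sums_unique2)
  have "of_real m * cis (- (of_int n * x)) + (\<Sum>i. b i * cis (of_int (int (Suc i) - n) * x)) =
      F0 (cis x) * cis (- (of_int n * x))" for x
  proof -
    have "cis x ^ Suc i * cis (- (of_int n * x)) = cis (of_int (int (Suc i) - n) * x)" for i
      unfolding Complex.DeMoivre cis_mult by (simp add: algebra_simps)
    then have "(\<Sum>i. b i * cis (of_int (int (Suc i) - n) * x)) =
        (\<Sum>i. b i * cis x ^ Suc i * cis (- (of_int n * x)))"
      by (simp only: mult.assoc)
    also have "\<dots> = (\<Sum>i. b i * cis x ^ Suc i) * cis (- (of_int n * x))"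
      by (rule suminf_mult2[symmetric, OF summable_F0]) simp
    finally show ?thesis
      by (simp add: F0_def distrib_right)
  qed
  moreover have "((\<lambda>x. of_real m * cis (- (of_int n * x)) + (\<Sum>i. b i * cis (of_int (int (Suc i) - n) * x)))
      has_integral of_real m * (if - n = 0 then of_real (2 * pi) else 0) + L) {0..2 * pi}"
    using has_integral_add[OF has_integral_mult_right[OF has_integral_cis[of "- n"]] L(1)] by simp
  ultimately show ?thesis
    by (auto simp: Leq mult.commute split: if_splits)
qed

text \<open>Taking the real part averages \<open>F0\<close> with its conjugate, which halves
  \<open>b\<close> and reflects it to the negative frequencies.\<close>

lemma fourier_coeff_initial:
  "fourier_coeff (u 0) n = (if n = 0 then of_real m else if n > 0 then b (nat n - 1) / 2
    else cnj (b (nat (- n) - 1)) / 2)"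
proof (rule fourier_coeffI[OF u_absolutely_integrable])
  let ?c = "\<lambda>n. of_real (2 * pi) * (if n = 0 then of_real m else if n > 0 then b (nat n - 1) else 0)"
  have "((\<lambda>x. 1 / 2 * (F0 (cis x) * cis (- (of_int n * x)) + cnj (F0 (cis x) * cis (- (of_int (- n) * x)))))
      has_integral 1 / 2 * (?c n + cnj (?c (- n)))) {0..2 * pi}"
    by (intro has_integral_mult_right has_integral_add has_integral_cnj has_integral_F0_fourier)
  moreover have "1 / 2 * (F0 (cis x) * cis (- (of_int n * x)) + cnj (F0 (cis x) * cis (- (of_int (- n) * x))))
      = of_real (u 0 x) * cis (- (of_int n * x))" for x
  proof -
    have "u 0 x = Re (F0 (cis x))"
      by (simp add: u_def f_def F_def Z_initial)
    then have "of_real (u 0 x) = (F0 (cis x) + cnj (F0 (cis x))) / 2"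
      by (simp add: complex_add_cnj)
    moreover have "cnj (F0 (cis x) * cis (- (of_int (- n) * x))) = cnj (F0 (cis x)) * cis (- (of_int n * x))"
      by (simp add: cis_cnj)
    ultimately show ?thesis
      by (simp only:) (simp add: distrib_right add_divide_distrib)
  qed
  moreover have "1 / 2 * (?c n + cnj (?c (- n))) = of_real (2 * pi) *
      (if n = 0 then of_real m else if n > 0 then b (nat n - 1) / 2 else cnj (b (nat (- n) - 1)) / 2)"
    by auto
  ultimately show "((\<lambda>x. of_real (u 0 x) * cis (- (of_int n * x))) has_integral of_real (2 * pi) *
      (if n = 0 then of_real m else if n > 0 then b (nat n - 1) / 2 else cnj (b (nat (- n) - 1)) / 2)) {0..2 * pi}"
    by (simp only:)
qed simp

end


text \<open>For a real function the frequencies n and -n contribute equally, hence the factor 2;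
  subtracting the mean removes frequency 0 only. Thus \<beta> can be the Wiener norm itself, and the
  decay estimate carries no extra constant.\<close>

lemma wiener_norm_minus_mean_sums:
  assumes f: "f \<in> wiener_space 0"
  shows "(\<lambda>n. norm (2 * fourier_coeff f (int (Suc n)))) sums wiener_norm 0 (\<lambda>x. f x - circle_mean f)"
proof -
  have int: "f absolutely_integrable_on {0..2 * pi}"
    and summable: "(\<lambda>n. cmod (fourier_coeff f n)) summable_on UNIV"
    using f by (simp_all add: wiener_space_def freq_weight_def)
  define a where "a n = (if n = 0 then 0 else cmod (fourier_coeff f n))" for n
  have const: "(\<lambda>x. circle_mean f) absolutely_integrable_on {0..2 * pi}"
    by (intro absolutely_integrable_continuous_real continuous_intros)
  have a: "a n = freq_weight 0 n * cmod (fourier_coeff (\<lambda>x. f x - circle_mean f) n)" for n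
    by (simp add: a_def freq_weight_def fourier_coeff_diff[OF int const] fourier_coeff_const fourier_coeff_0[OF int])
  have norm: "wiener_norm 0 (\<lambda>x. f x - circle_mean f) = infsum a UNIV"
    unfolding wiener_norm_def a[symmetric] ..
  have "(\<lambda>n. 2 * a (int (Suc n))) sums infsum a UNIV"
  proof (rule sums_of_even_summable)
    show "a summable_on UNIV"
      by (rule summable_on_comparison_test[OF summable]) (auto simp: a_def)
  qed (auto simp: a_def fourier_coeff_uminus[OF int])
  then show ?thesis
    by (simp add: norm a_def norm_mult)
qed

theorem theorem3:
  shows "\<exists>C>0. \<exists>\<delta> :: real \<Rightarrow> real. (\<forall>m>0. \<delta> m > 0) \<and>
    (\<forall>u0 \<in> wiener_space 0.
       (\<forall>x. u0 x > 0) \<longrightarrow>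
       wiener_norm 0 (\<lambda>x. u0 x - circle_mean u0) / circle_mean u0 \<le> C \<longrightarrow>
       (\<exists>u. global_weak_solution u0 u \<and>
          (\<forall>T>0. in_Linfty T u \<and> in_L2_sobolev T (1/2) u) \<and>
          (AE t in lebesgue. t \<ge> 0 \<longrightarrow>
             Linfty_norm (lebesgue_on {0..2*pi}) (\<lambda>x. u t x - circle_mean u0)
               \<le> ereal (wiener_norm 0 (\<lambda>x. u0 x - circle_mean u0) * exp (- \<delta> (circle_mean u0) * t)))))"
\<comment> \<open>The witnesses are the smallness threshold of the locale and its rate
  \<open>\<delta>\<close>, which depends on the mean alone.\<close>
proof (intro exI[of _ "1 / 4"] exI[of _ "\<lambda>m. 4 / (5 * m)"] conjI ballI impI)
  fix u0 assume u0: "u0 \<in> wiener_space 0" and pos: "\<forall>x. u0 x > 0"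
    and small: "wiener_norm 0 (\<lambda>x. u0 x - circle_mean u0) / circle_mean u0 \<le> 1 / 4"
  define m where "m = circle_mean u0"
  define \<beta> where "\<beta> = wiener_norm 0 (\<lambda>x. u0 x - m)"
  \<comment> \<open>The factor 2 makes the real part of \<open>F0\<close> on the circle have the
    coefficients of the datum.\<close>
  define b where "b n = 2 * fourier_coeff u0 (int (Suc n))" for n
  have int: "u0 absolutely_integrable_on {0..2 * pi}"
    using u0 by (simp add: wiener_space_def)
  have m: "m > 0"
    unfolding m_def using pos by (intro circle_mean_pos int) auto
  interpret small_datum m \<beta> b
  proof
    show "(\<lambda>n. norm (b n)) sums \<beta>"
      unfolding b_def \<beta>_def m_def by (rule wiener_norm_minus_mean_sums[OF u0])
    show "\<beta> \<le> m / 4"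
      using small m by (simp add: \<beta>_def m_def[symmetric] divide_le_eq)
  qed fact
  have coeff: "fourier_coeff (u 0) n = fourier_coeff u0 n" for n
  proof -
    consider "n = 0" | "n > 0" | "n < 0"
      by linarith
    then show ?thesis
    proof cases
      case 3
      then show ?thesis
        using fourier_coeff_uminus[OF int, of n] by (simp add: fourier_coeff_initial b_def)
    qed (simp_all add: fourier_coeff_initial b_def fourier_coeff_0[OF int] m_def[symmetric])
  qed
  \<comment> \<open>\<open>u0\<close> is given only as an integrable function and may differ from
    the continuous \<open>u 0\<close> on a null set, so the two are exchanged under the integral, by
    equality of their Fourier coefficients.\<close>
  have initial: "integral {0..2 * pi} (\<lambda>x. u 0 x * \<phi> x) = (LINT x:{0..2 * pi}|lebesgue. u0 x * \<phi> x)"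
    if cont: "continuous_on UNIV \<phi>" and per: "periodic \<phi>" for \<phi>
  proof -
    have ai: "(\<lambda>x. g x * \<phi> x) absolutely_integrable_on {0..2 * pi}"
      if "g absolutely_integrable_on {0..2 * pi}" for g
      using absolutely_integrable_scaleR_continuous[OF that continuous_on_subset[OF cont]] by simp
    note ints = ai[OF int] ai[OF u_absolutely_integrable[OF order_refl]]
    have "integral {0..2 * pi} (\<lambda>x. (u0 x - u 0 x) * \<phi> x) = 0"
      using int u_absolutely_integrable[of 0]
      by (intro integral_eq_0_of_fourier_coeff_eq_0 cont per set_integral_diff(1))
         (simp_all add: fourier_coeff_diff coeff)
    then have "integral {0..2 * pi} (\<lambda>x. u0 x * \<phi> x) = integral {0..2 * pi} (\<lambda>x. u 0 x * \<phi> x)"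
      using integral_diff[OF ints[THEN set_lebesgue_integral_eq_integral(1)]]
      by (simp add: left_diff_distrib)
    then show ?thesis
      using set_lebesgue_integral_eq_integral(2)[OF ints(1)] by simp
  qed
  show "\<exists>u. global_weak_solution u0 u \<and>
          (\<forall>T>0. in_Linfty T u \<and> in_L2_sobolev T (1/2) u) \<and>
          (AE t in lebesgue. t \<ge> 0 \<longrightarrow>
             Linfty_norm (lebesgue_on {0..2*pi}) (\<lambda>x. u t x - circle_mean u0)
               \<le> ereal (wiener_norm 0 (\<lambda>x. u0 x - circle_mean u0) * exp (- (4 / (5 * circle_mean u0)) * t)))"
  proof (intro exI[of _ u] conjI allI impI)
    show "global_weak_solution u0 u"
      unfolding global_weak_solution_def
    proof (intro conjI allI impI)
      fix T \<phi> assume T: "T > 0" and test: "test_function T \<phi>"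
      have "continuous_on UNIV (\<phi> 0)"
      proof (rule test_functionE[OF test])
        fix \<phi>x
        assume "\<And>t x. t \<in> {0..<T} \<Longrightarrow> (\<phi> t has_real_derivative \<phi>x t x) (at x)"
        then show ?thesis
          using T by (intro DERIV_continuous_on[of _ _ "\<phi>x 0"]) auto
      qed
      moreover have "periodic (\<phi> 0)"
        using test T by (simp add: test_function_def)
      ultimately show "- (LINT s:{0..<T}|lebesgue. LINT x:{0..2*pi}|lebesgue.
            u s x * vector_derivative (\<lambda>\<tau>. \<phi> \<tau> x) (at s within {0..<T}) + flux u s x * deriv (\<phi> s) x)
          = (LINT x:{0..2*pi}|lebesgue. u0 x * \<phi> 0 x)"
        unfolding weak_identity[OF test] by (rule initial)
    qed (rule periodic_u absolutely_integrable_spacetime continuous_on_u AE_hilbert_exists flux_integrable)+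
    show "AE t in lebesgue. t \<ge> 0 \<longrightarrow>
        Linfty_norm (lebesgue_on {0..2*pi}) (\<lambda>x. u t x - circle_mean u0)
          \<le> ereal (wiener_norm 0 (\<lambda>x. u0 x - circle_mean u0) * exp (- (4 / (5 * circle_mean u0)) * t))"
      using Linfty_norm_u_minus_mean_le
      by (intro AE_I2) (simp add: m_def[symmetric] \<beta>_def[symmetric] radius_def \<delta>_def)
  qed (rule in_Linfty_u in_L2_sobolev_u; assumption?)+
qed auto

end
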